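(* $\Vdash\forall i^{\gimel2}\big(i\neq0,\ i\neq1\to(\gimel\kappa_+\text{ cannot be well ordered})\big)$; that is, in the realizability model $\mathcal N_{\mathcal A}$, if the Boolean algebra $\gimel2$ has an element other than $0$ and $1$, then $\gimel\kappa_+$ is not well orderable.
   Context: Realizability algebra $\mathcal A$ (terms $\Lambda$, stacks $\Pi$, instructions $B,C,I,K,W,\mathrm{cc}$, continuations $k_\pi$, execution $\succ$ given by $(\xi)\eta\star\pi\succ\xi\star\eta\cdot\pi$, $I\star\xi\cdot\pi\succ\xi\star\pi$, $K\star\xi\cdot\eta\cdot\pi\succ\xi\star\pi$, $W\star\xi\cdot\eta\cdot\pi\succ\xi\star\eta\cdot\eta\cdot\pi$, $C\star\xi\cdot\eta\cdot\zeta\cdot\pi\succ\xi\star\zeta\cdot\eta\cdot\pi$, $B\star\xi\cdot\eta\cdot\zeta\cdot\pi\succ\xi\star(\eta)\zeta\cdot\pi$, $\mathrm{cc}\star\xi\cdot\pi\succ\xi\star k_\pi\cdot\pi$, $k_\pi\star\xi\cdot\varpi\succ\xi\star\pi$; set $\perp\!\!\!\perp$ of processes closed under anti-execution; proof-like terms QP containing the instructions and closed under application), coherent (for each $\theta\in$ QP some $\pi$ has $\theta\star\pi\notin\perp\!\!\!\perp$), in a ground model $\mathcal M\models$ ZF+$V=L$. Realizability model $\mathcal N_{\mathcal A}$: individuals of $\mathcal M$; $\|\top\|=\emptyset$, $\|\bot\|=\Pi$, $\|a\not\varepsilon b\|=\{\pi:(a,\pi)\in b\}$, $\|a\subset b\|=\bigcup_c\{\xi\cdot\pi:(c,\pi)\in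 a,\xi\Vdash c\notin b\}$, $\|a\notin b\|=\bigcup_c\{\xi\cdot\xi'\cdot\pi:(c,\pi)\in b,\xi\Vdash a\subset c,\xi'\Vdash c\subset a\}$, $\|A\to B\|=\{\xi\cdot\pi:\xi\Vdash A,\pi\in\|B\|\}$, $\|\forall xA\|=\bigcup_a\|A[a/x]\|$; $\xi\Vdash F$ iff $\xi\star\pi\in\perp\!\!\!\perp$ for all $\pi\in\|F\|$; $\Vdash F$ means some proof-like term realizes $F$. $\gimel X=X\times\Pi$, $\|\forall x^{\gimel X}F\|=\bigcup_{a\in X}\|F[a]\|$; $\gimel2$ is the characteristic Boolean algebra (operations of $\{0,1\}$ extended to $\mathcal N_{\mathcal A}$). For $j\in\{0,1\}$, $i\ne j$ has falsity value $\Pi$ if $i=j$ and $\emptyset$ otherwise. In $\mathcal M$, $\kappa=\mathrm{card}(\Lambda\cup\Pi\cup\mathbb N)$ and $\kappa_+=\mathcal P(\kappa)$. *)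

theory Defs
  imports Main
begin

section \<open>The ground model\<close>

text \<open>
  First-order formulas of the language of set theory, with de Bruijn indices; they serve to state
  the axiom schemes of ZF.  The ground model is an arbitrary structure for this language: it need not
  be well founded from the outside, so every recursion below is carried out inside the model.
\<close>

datatype fml = MemF nat nat | EqF nat nat | NegF fml | ConF fml fml | AllF fml

primrec sat :: "('m \<Rightarrow> 'm \<Rightarrow> bool) \<Rightarrow> (nat \<Rightarrow> 'm) \<Rightarrow> fml \<Rightarrow> bool" where
  "sat mem e (MemF i j) \<longleftrightarrow> mem (e i) (e j)"
| "sat mem e (EqF i j) \<longleftrightarrow> e i = e j"
| "sat mem e (NegF p) \<longleftrightarrow> \<not> sat mem e p"
| "sat mem e (ConF p q) \<longleftrightarrow> sat mem e p \<and> sat mem e q"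
| "sat mem e (AllF p) \<longleftrightarrow> (\<forall>x. sat mem (case_nat x e) p)"

locale set_structure =
  fixes mem :: "'m \<Rightarrow> 'm \<Rightarrow> bool"  (infix "\<in>\<^sub>M" 50)
begin

definition sub :: "'m \<Rightarrow> 'm \<Rightarrow> bool"  (infix "\<subseteq>\<^sub>M" 50) where
  "a \<subseteq>\<^sub>M b \<longleftrightarrow> (\<forall>x. x \<in>\<^sub>M a \<longrightarrow> x \<in>\<^sub>M b)"

text \<open>
  The following descriptions denote in every model of ZF.
\<close>

definition zero :: 'm where
  "zero = (THE z. \<forall>x. \<not> x \<in>\<^sub>M z)"

definition upair :: "'m \<Rightarrow> 'm \<Rightarrow> 'm" where
  "upair a b = (THE z. \<forall>x. x \<in>\<^sub>M z \<longleftrightarrow> x = a \<or> x = b)"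

definition pair :: "'m \<Rightarrow> 'm \<Rightarrow> 'm" where
  "pair a b = upair (upair a a) (upair a b)"

definition union :: "'m \<Rightarrow> 'm \<Rightarrow> 'm" where
  "union a b = (THE z. \<forall>x. x \<in>\<^sub>M z \<longleftrightarrow> x \<in>\<^sub>M a \<or> x \<in>\<^sub>M b)"

definition succ :: "'m \<Rightarrow> 'm" where
  "succ a = union a (upair a a)"

definition one :: 'm where
  "one = succ zero"

definition two :: 'm where
  "two = succ one"

definition powerset :: "'m \<Rightarrow> 'm" where
  "powerset a = (THE z. \<forall>x. x \<in>\<^sub>M z \<longleftrightarrow> x \<subseteq>\<^sub>M a)"

definition cart :: "'m \<Rightarrow> 'm \<Rightarrow> 'm" where
  "cart a b = (THE z. \<forall>p. p \<in>\<^sub>M z \<longleftrightarrow> (\<exists>x y. x \<in>\<^sub>M a \<and> y \<in>\<^sub>M b \<and> p = pair x y))"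

definition is_inductive :: "'m \<Rightarrow> bool" where
  "is_inductive w \<longleftrightarrow> zero \<in>\<^sub>M w \<and> (\<forall>x. x \<in>\<^sub>M w \<longrightarrow> succ x \<in>\<^sub>M w)"

definition omega :: 'm where
  "omega = (THE w. is_inductive w \<and> (\<forall>v. is_inductive v \<longrightarrow> w \<subseteq>\<^sub>M v))"

definition is_fun :: "'m \<Rightarrow> 'm \<Rightarrow> 'm \<Rightarrow> bool" where
  "is_fun f a b \<longleftrightarrow> f \<subseteq>\<^sub>M cart a b \<and> (\<forall>x. x \<in>\<^sub>M a \<longrightarrow> (\<exists>!y. pair x y \<in>\<^sub>M f))"

definition app :: "'m \<Rightarrow> 'm \<Rightarrow> 'm" where
  "app f x = (THE y. pair x y \<in>\<^sub>M f)"

definition is_bij :: "'m \<Rightarrow> 'm \<Rightarrow> 'm \<Rightarrow> bool" where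
  "is_bij f a b \<longleftrightarrow> is_fun f a b \<and> (\<forall>y. y \<in>\<^sub>M b \<longrightarrow> (\<exists>!x. pair x y \<in>\<^sub>M f))"

definition transitive :: "'m \<Rightarrow> bool" where
  "transitive a \<longleftrightarrow> (\<forall>x. x \<in>\<^sub>M a \<longrightarrow> x \<subseteq>\<^sub>M a)"

definition ordinal :: "'m \<Rightarrow> bool" where
  "ordinal a \<longleftrightarrow> transitive a \<and> (\<forall>x. x \<in>\<^sub>M a \<longrightarrow> transitive x)"

definition is_card :: "'m \<Rightarrow> 'm \<Rightarrow> bool" where
  "is_card k a \<longleftrightarrow> ordinal k \<and> (\<exists>f. is_bij f k a) \<and> (\<forall>x. x \<in>\<^sub>M k \<longrightarrow> \<not> (\<exists>f. is_bij f x a))"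

definition extensionality :: bool where
  "extensionality \<longleftrightarrow> (\<forall>a b. (\<forall>x. x \<in>\<^sub>M a \<longleftrightarrow> x \<in>\<^sub>M b) \<longrightarrow> a = b)"

definition foundation :: bool where
  "foundation \<longleftrightarrow>
    (\<forall>a. (\<exists>x. x \<in>\<^sub>M a) \<longrightarrow> (\<exists>x. x \<in>\<^sub>M a \<and> \<not> (\<exists>y. y \<in>\<^sub>M x \<and> y \<in>\<^sub>M a)))"

definition pairing_axiom :: bool where
  "pairing_axiom \<longleftrightarrow> (\<forall>a b. \<exists>z. \<forall>x. x \<in>\<^sub>M z \<longleftrightarrow> x = a \<or> x = b)"

definition union_axiom :: bool where
  "union_axiom \<longleftrightarrow> (\<forall>a. \<exists>z. \<forall>x. x \<in>\<^sub>M z \<longleftrightarrow> (\<exists>y. x \<in>\<^sub>M y \<and> y \<in>\<^sub>M a))"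

definition powerset_axiom :: bool where
  "powerset_axiom \<longleftrightarrow> (\<forall>a. \<exists>z. \<forall>x. x \<in>\<^sub>M z \<longleftrightarrow> x \<subseteq>\<^sub>M a)"

definition infinity_axiom :: bool where
  "infinity_axiom \<longleftrightarrow>
    (\<exists>w. (\<exists>z. z \<in>\<^sub>M w \<and> (\<forall>x. \<not> x \<in>\<^sub>M z)) \<and>
         (\<forall>x. x \<in>\<^sub>M w \<longrightarrow> (\<exists>y. y \<in>\<^sub>M w \<and> (\<forall>u. u \<in>\<^sub>M y \<longleftrightarrow> u \<in>\<^sub>M x \<or> u = x))))"

definition separation_scheme :: bool where
  "separation_scheme \<longleftrightarrow>
    (\<forall>p e a. \<exists>z. \<forall>x. x \<in>\<^sub>M z \<longleftrightarrow> x \<in>\<^sub>M a \<and> sat mem (case_nat x e) p)"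

definition replacement_scheme :: bool where
  "replacement_scheme \<longleftrightarrow>
    (\<forall>p e a.
      (\<forall>x y y'. x \<in>\<^sub>M a \<and> sat mem (case_nat x (case_nat y e)) p \<and>
                sat mem (case_nat x (case_nat y' e)) p \<longrightarrow> y = y') \<longrightarrow>
      (\<exists>z. \<forall>y. y \<in>\<^sub>M z \<longleftrightarrow> (\<exists>x. x \<in>\<^sub>M a \<and> sat mem (case_nat x (case_nat y e)) p)))"

definition ZF :: bool where
  "ZF \<longleftrightarrow> extensionality \<and> foundation \<and> pairing_axiom \<and> union_axiom \<and> powerset_axiom \<and>
    infinity_axiom \<and> separation_scheme \<and> replacement_scheme"


subsection \<open>Constructible sets\<close>

text \<open>
  The definable subsets of \<open>a\<close> are obtained from the least family \<open>D\<close> of pairs \<open>(n, R)\<close>, where \<open>R\<close> is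
  a set of functions \<open>n \<rightarrow> a\<close>, that contains the relations given by \<open>t(i) \<in> t(j)\<close> and \<open>t(i) = t(j)\<close> and
  is closed under complement, intersection and projection.  Natural numbers are those of the model,
  so formulas of nonstandard length are covered when the model has them.
\<close>

definition is_rel :: "'m \<Rightarrow> 'm \<Rightarrow> ('m \<Rightarrow> bool) \<Rightarrow> 'm \<Rightarrow> bool" where
  "is_rel a n P R \<longleftrightarrow> (\<forall>t. t \<in>\<^sub>M R \<longleftrightarrow> is_fun t n a \<and> P t)"

definition def_closed :: "'m \<Rightarrow> 'm \<Rightarrow> bool" where
  "def_closed a D \<longleftrightarrow>
    (\<forall>n i j R. n \<in>\<^sub>M omega \<and> i \<in>\<^sub>M n \<and> j \<in>\<^sub>M n \<and> is_rel a n (\<lambda>t. app t i \<in>\<^sub>M app t j) R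
        \<longrightarrow> pair n R \<in>\<^sub>M D) \<and>
    (\<forall>n i j R. n \<in>\<^sub>M omega \<and> i \<in>\<^sub>M n \<and> j \<in>\<^sub>M n \<and> is_rel a n (\<lambda>t. app t i = app t j) R
        \<longrightarrow> pair n R \<in>\<^sub>M D) \<and>
    (\<forall>n Q R. n \<in>\<^sub>M omega \<and> pair n Q \<in>\<^sub>M D \<and> is_rel a n (\<lambda>t. \<not> t \<in>\<^sub>M Q) R
        \<longrightarrow> pair n R \<in>\<^sub>M D) \<and>
    (\<forall>n P Q R. n \<in>\<^sub>M omega \<and> pair n P \<in>\<^sub>M D \<and> pair n Q \<in>\<^sub>M D \<and>
                is_rel a n (\<lambda>t. t \<in>\<^sub>M P \<and> t \<in>\<^sub>M Q) R
        \<longrightarrow> pair n R \<in>\<^sub>M D) \<and>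
    (\<forall>n Q R. n \<in>\<^sub>M omega \<and> pair (succ n) Q \<in>\<^sub>M D \<and> is_rel a n (\<lambda>t. \<exists>u. u \<in>\<^sub>M Q \<and> t \<subseteq>\<^sub>M u) R
        \<longrightarrow> pair n R \<in>\<^sub>M D)"

definition definable_in :: "'m \<Rightarrow> 'm \<Rightarrow> bool" where
  "definable_in a x \<longleftrightarrow>
    (\<exists>n s R. n \<in>\<^sub>M omega \<and> is_fun s n a \<and> (\<forall>D. def_closed a D \<longrightarrow> pair (succ n) R \<in>\<^sub>M D) \<and>
      (\<forall>y. y \<in>\<^sub>M x \<longleftrightarrow> y \<in>\<^sub>M a \<and> (\<exists>t. t \<in>\<^sub>M R \<and> s \<subseteq>\<^sub>M t \<and> pair n y \<in>\<^sub>M t)))"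

text \<open>
  The function \<open>f\<close> is the constructible hierarchy up to \<open>k\<close>: its value at each \<open>b\<close> is the union over
  \<open>c \<in> b\<close> of the definable power sets of its values at \<open>c\<close>.
\<close>

definition constructible :: "'m \<Rightarrow> bool" where
  "constructible x \<longleftrightarrow>
    (\<exists>k v f. ordinal k \<and> is_fun f (succ k) v \<and>
      (\<forall>b. b \<in>\<^sub>M succ k \<longrightarrow>
        (\<forall>y. y \<in>\<^sub>M app f b \<longleftrightarrow> (\<exists>c. c \<in>\<^sub>M b \<and> definable_in (app f c) y))) \<and>
      x \<in>\<^sub>M app f k)"

definition V_eq_L :: bool where
  "V_eq_L \<longleftrightarrow> (\<forall>x. constructible x)"

end


section \<open>Realizability algebras\<close>

text \<open>
  All components are individuals of the ground model; in particular the operations are functions in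
  the sense of the model.
\<close>

record 'm realizability_structure =
  Terms :: 'm
  Stacks :: 'm
  Processes :: 'm
  Apply :: 'm
  Push :: 'm
  Star :: 'm
  Cont :: 'm
  InsB :: 'm
  InsC :: 'm
  InsI :: 'm
  InsK :: 'm
  InsW :: 'm
  InsCC :: 'm
  ProofLike :: 'm
  Exec :: 'm
  Pole :: 'm

text \<open>
  Closed formulas of the language of \<open>ZF\<^sub>\<epsilon>\<close> with parameters in the ground model.  A formula with
  a free variable is represented by the family of its instances, and function symbols, which denote
  functions on the ground model, are applied directly to individuals.
\<close>

datatype 'm zfe =
    Top
  | Bot
  | NotEps 'm 'm
  | NotIn 'm 'm
  | Incl 'm 'm
  | Neq 'm 'm
  | Imp "'m zfe" "'m zfe"  (infixr "\<^bold>\<rightarrow>" 25)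
  | Forall "'m \<Rightarrow> 'm zfe"
  | ForallGimel 'm "'m \<Rightarrow> 'm zfe"

definition Neg :: "'m zfe \<Rightarrow> 'm zfe" where
  "Neg F = (F \<^bold>\<rightarrow> Bot)"

definition Conj :: "'m zfe \<Rightarrow> 'm zfe \<Rightarrow> 'm zfe"  (infixr "\<^bold>\<and>" 35) where
  "(F \<^bold>\<and> G) = ((F \<^bold>\<rightarrow> G \<^bold>\<rightarrow> Bot) \<^bold>\<rightarrow> Bot)"

definition Exists :: "('m \<Rightarrow> 'm zfe) \<Rightarrow> 'm zfe" where
  "Exists F = Neg (Forall (\<lambda>x. Neg (F x)))"

definition Eps :: "'m \<Rightarrow> 'm \<Rightarrow> 'm zfe" where
  "Eps a b = Neg (NotEps a b)"

locale realizability_model = set_structure mem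
  for mem :: "'m \<Rightarrow> 'm \<Rightarrow> bool"  (infix "\<in>\<^sub>M" 50) +
  fixes A :: "'m realizability_structure"
begin

definition ap :: "'m \<Rightarrow> 'm \<Rightarrow> 'm" where
  "ap x y = app (Apply A) (pair x y)"

definition push :: "'m \<Rightarrow> 'm \<Rightarrow> 'm"  (infixr "\<^bold>\<cdot>" 70) where
  "x \<^bold>\<cdot> p = app (Push A) (pair x p)"

definition star :: "'m \<Rightarrow> 'm \<Rightarrow> 'm"  (infix "\<star>" 60) where
  "x \<star> p = app (Star A) (pair x p)"

definition cont :: "'m \<Rightarrow> 'm" where
  "cont p = app (Cont A) p"

definition exec :: "'m \<Rightarrow> 'm \<Rightarrow> bool"  (infix "\<succ>" 50) where
  "p \<succ> q \<longleftrightarrow> pair p q \<in>\<^sub>M Exec A"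

abbreviation is_term :: "'m \<Rightarrow> bool" where
  "is_term x \<equiv> x \<in>\<^sub>M Terms A"

abbreviation is_stack :: "'m \<Rightarrow> bool" where
  "is_stack p \<equiv> p \<in>\<^sub>M Stacks A"

definition realizability_algebra :: bool where
  "realizability_algebra \<longleftrightarrow>
    is_fun (Apply A) (cart (Terms A) (Terms A)) (Terms A) \<and>
    is_fun (Push A) (cart (Terms A) (Stacks A)) (Stacks A) \<and>
    is_fun (Star A) (cart (Terms A) (Stacks A)) (Processes A) \<and>
    is_fun (Cont A) (Stacks A) (Terms A) \<and>
    ProofLike A \<subseteq>\<^sub>M Terms A \<and>
    (\<forall>x \<in> {InsB A, InsC A, InsI A, InsK A, InsW A, InsCC A}. x \<in>\<^sub>M ProofLike A) \<and>
    (\<forall>x y. x \<in>\<^sub>M ProofLike A \<and> y \<in>\<^sub>M ProofLike A \<longrightarrow> ap x y \<in>\<^sub>M ProofLike A) \<and>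
    Exec A \<subseteq>\<^sub>M cart (Processes A) (Processes A) \<and>
    (\<forall>p. p \<in>\<^sub>M Processes A \<longrightarrow> p \<succ> p) \<and>
    (\<forall>p q r. p \<succ> q \<and> q \<succ> r \<longrightarrow> p \<succ> r) \<and>
    (\<forall>x y p. is_term x \<and> is_term y \<and> is_stack p \<longrightarrow> ap x y \<star> p \<succ> x \<star> y \<^bold>\<cdot> p) \<and>
    (\<forall>x p. is_term x \<and> is_stack p \<longrightarrow> InsI A \<star> x \<^bold>\<cdot> p \<succ> x \<star> p) \<and>
    (\<forall>x y p. is_term x \<and> is_term y \<and> is_stack p \<longrightarrow> InsK A \<star> x \<^bold>\<cdot> y \<^bold>\<cdot> p \<succ> x \<star> p) \<and>
    (\<forall>x y p. is_term x \<and> is_term y \<and> is_stack p \<longrightarrow>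
      InsW A \<star> x \<^bold>\<cdot> y \<^bold>\<cdot> p \<succ> x \<star> y \<^bold>\<cdot> y \<^bold>\<cdot> p) \<and>
    (\<forall>x y z p. is_term x \<and> is_term y \<and> is_term z \<and> is_stack p \<longrightarrow>
      InsC A \<star> x \<^bold>\<cdot> y \<^bold>\<cdot> z \<^bold>\<cdot> p \<succ> x \<star> z \<^bold>\<cdot> y \<^bold>\<cdot> p) \<and>
    (\<forall>x y z p. is_term x \<and> is_term y \<and> is_term z \<and> is_stack p \<longrightarrow>
      InsB A \<star> x \<^bold>\<cdot> y \<^bold>\<cdot> z \<^bold>\<cdot> p \<succ> x \<star> ap y z \<^bold>\<cdot> p) \<and>
    (\<forall>x p. is_term x \<and> is_stack p \<longrightarrow> InsCC A \<star> x \<^bold>\<cdot> p \<succ> x \<star> cont p \<^bold>\<cdot> p) \<and>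
    (\<forall>x p q. is_term x \<and> is_stack p \<and> is_stack q \<longrightarrow> cont p \<star> x \<^bold>\<cdot> q \<succ> x \<star> p) \<and>
    Pole A \<subseteq>\<^sub>M Processes A \<and>
    (\<forall>p q. p \<succ> q \<and> q \<in>\<^sub>M Pole A \<longrightarrow> p \<in>\<^sub>M Pole A)"

definition coherent :: bool where
  "coherent \<longleftrightarrow> (\<forall>x. x \<in>\<^sub>M ProofLike A \<longrightarrow> (\<exists>p. is_stack p \<and> \<not> x \<star> p \<in>\<^sub>M Pole A))"

definition gimel :: "'m \<Rightarrow> 'm" where
  "gimel a = cart a (Stacks A)"


subsection \<open>Falsity values\<close>

text \<open>
  The falsity values of \<open>x \<subset> y\<close> and \<open>x \<notin> y\<close> are defined by a simultaneous recursion inside the ground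
  model.  Here \<open>S\<close> and \<open>N\<close> are sets of triples \<open>((x, y), p)\<close> that collect, for \<open>x\<close> and \<open>y\<close> in the transitive
  set \<open>t\<close>, the stacks \<open>p\<close> in the two falsity values.  In a model of ZF such \<open>S\<close> and \<open>N\<close> exist for each
  \<open>t\<close>, and their restrictions to \<open>t\<close> are unique.
\<close>

definition falsity_rec :: "'m \<Rightarrow> 'm \<Rightarrow> 'm \<Rightarrow> bool" where
  "falsity_rec t S N \<longleftrightarrow> transitive t \<and>
    (\<forall>x y. x \<in>\<^sub>M t \<and> y \<in>\<^sub>M t \<longrightarrow>
      (\<forall>q. pair (pair x y) q \<in>\<^sub>M S \<longleftrightarrow>
        (\<exists>c u p. is_term u \<and> is_stack p \<and> pair c p \<in>\<^sub>M x \<and> q = u \<^bold>\<cdot> p \<and>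
          (\<forall>r. pair (pair c y) r \<in>\<^sub>M N \<longrightarrow> u \<star> r \<in>\<^sub>M Pole A))) \<and>
      (\<forall>q. pair (pair x y) q \<in>\<^sub>M N \<longleftrightarrow>
        (\<exists>c u u' p. is_term u \<and> is_term u' \<and> is_stack p \<and> pair c p \<in>\<^sub>M y \<and> q = u \<^bold>\<cdot> u' \<^bold>\<cdot> p \<and>
          (\<forall>r. pair (pair x c) r \<in>\<^sub>M S \<longrightarrow> u \<star> r \<in>\<^sub>M Pole A) \<and>
          (\<forall>r. pair (pair c x) r \<in>\<^sub>M S \<longrightarrow> u' \<star> r \<in>\<^sub>M Pole A))))"

primrec falsity :: "'m zfe \<Rightarrow> 'm set" where
  "falsity Top = {}"
| "falsity Bot = {p. is_stack p}"
| "falsity (NotEps a b) = {p. is_stack p \<and> pair a p \<in>\<^sub>M b}"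
| "falsity (NotIn a b) =
    {p. \<exists>t S N. falsity_rec t S N \<and> a \<in>\<^sub>M t \<and> b \<in>\<^sub>M t \<and> pair (pair a b) p \<in>\<^sub>M N}"
| "falsity (Incl a b) =
    {p. \<exists>t S N. falsity_rec t S N \<and> a \<in>\<^sub>M t \<and> b \<in>\<^sub>M t \<and> pair (pair a b) p \<in>\<^sub>M S}"
| "falsity (Neq a b) = (if a = b then {p. is_stack p} else {})"
| "falsity (F \<^bold>\<rightarrow> G) =
    {x \<^bold>\<cdot> p | x p. is_term x \<and> (\<forall>q \<in> falsity F. x \<star> q \<in>\<^sub>M Pole A) \<and> p \<in> falsity G}"
| "falsity (Forall F) = (\<Union>a. falsity (F a))"
| "falsity (ForallGimel X F) = (\<Union>a \<in> {a. a \<in>\<^sub>M X}. falsity (F a))"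

definition realizes :: "'m \<Rightarrow> 'm zfe \<Rightarrow> bool"  (infix "\<tturnstile>" 20) where
  "(x \<tturnstile> F) \<longleftrightarrow> is_term x \<and> (\<forall>p \<in> falsity F. x \<star> p \<in>\<^sub>M Pole A)"

definition realized :: "'m zfe \<Rightarrow> bool" where
  "realized F \<longleftrightarrow> (\<exists>x. x \<in>\<^sub>M ProofLike A \<and> (x \<tturnstile> F))"


subsection \<open>Well-orderability\<close>

text \<open>
  The formula stating that \<open>r\<close>, regarded as the relation \<open>(x, y) \<epsilon> r\<close>, is a strict well-ordering of the
  \<open>\<epsilon>\<close>-elements of \<open>u\<close>.  Membership is the strong, non-extensional one, distinctness is the
  predicate \<open>\<noteq>\<close>, and the pairing function of the ground model is used as a function symbol.
\<close>

definition well_orders :: "'m \<Rightarrow> 'm \<Rightarrow> 'm zfe" where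
  "well_orders r u =
    (Forall (\<lambda>x. Eps x u \<^bold>\<rightarrow> NotEps (pair x x) r) \<^bold>\<and>
     Forall (\<lambda>x. Forall (\<lambda>y. Forall (\<lambda>z. Eps x u \<^bold>\<rightarrow> Eps y u \<^bold>\<rightarrow> Eps z u \<^bold>\<rightarrow>
       Eps (pair x y) r \<^bold>\<rightarrow> Eps (pair y z) r \<^bold>\<rightarrow> Eps (pair x z) r))) \<^bold>\<and>
     Forall (\<lambda>x. Forall (\<lambda>y. Eps x u \<^bold>\<rightarrow> Eps y u \<^bold>\<rightarrow>
       Neq x y \<^bold>\<rightarrow> NotEps (pair x y) r \<^bold>\<rightarrow> Eps (pair y x) r)) \<^bold>\<and>
     Forall (\<lambda>e. Forall (\<lambda>x. Eps x e \<^bold>\<rightarrow> Eps x u) \<^bold>\<rightarrow> Exists (\<lambda>x. Eps x e) \<^bold>\<rightarrow>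
       Exists (\<lambda>x. Eps x e \<^bold>\<and> Forall (\<lambda>y. Eps y e \<^bold>\<rightarrow> NotEps (pair y x) r))))"

definition well_orderable :: "'m \<Rightarrow> 'm zfe" where
  "well_orderable u = Exists (\<lambda>r. well_orders r u)"

end

end

theory Submission
  imports Defs
begin

text \<open>
  An element \<open>i\<close> of \<open>\<gimel>2\<close> other than 0 and 1 splits \<open>\<gimel>U\<close>, for \<open>U = \<P>(\<kappa>)\<close>, into a product \<open>X \<times> Y\<close> of its
  parts below \<open>i\<close> and below the complement of \<open>i\<close>.  Going through \<open>X \<times> Y\<close> along a well-ordering and
  selecting each pair that shares no coordinate with one selected before gives a matching \<open>G\<close> that
  covers \<open>X\<close> or covers \<open>Y\<close>.  Neither is possible: in the thread \<open>i = 0\<close> only the \<open>Y\<close>-coordinate is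
  visible, and if no \<open>y \<in> U\<close> were uncovered, each \<open>y\<close> would have a stack refuting that it is uncovered;
  as \<open>G\<close> is a matching, no stack does so for two values of \<open>y\<close>, so that a partial function from \<open>\<Pi>\<close>
  would be onto \<open>\<P>(\<kappa>)\<close>, contradicting Cantor's theorem; the thread \<open>i = 1\<close> is symmetric.  The selection is the predicate \<open>matched\<close>, which
  quantifies over approximations to \<open>G\<close>, so that only induction along the ordering is needed.
\<close>

section \<open>Definable predicates and basic set theory\<close>

text \<open>Three constraints shape the realizers. Quantification over \<open>two\<close> is a union
  of falsity values, so one term must serve i = 0 and i = 1 alike. In each thread one of the
  hypotheses i \<noteq> 0 and i \<noteq> 1 has falsity value \<Pi> and yields everything, while the
  other has the empty falsity value and carries no information; the term therefore uses one of them
  for the coordinate in X and the other for the coordinate in Y. An uncovered point is looked for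
  only after the terms are fixed, in the ground model and separately in each thread. It may depend
  on both, because a realizer of a universal formula never sees the instance. This is why a purely
  classical counting argument can supply it. Finally, falsity values are sets of individuals formed
  outside the ground model, which need not be well founded. Every set used inside, such as the set
  of counterexamples in an induction or the diagonal set, must come from separation, so each family
  of formulas involved has to be shown definable with parameters.\<close>

primrec rename :: "(nat \<Rightarrow> nat) \<Rightarrow> fml \<Rightarrow> fml" where
  "rename s (MemF i j) = MemF (s i) (s j)"
| "rename s (EqF i j) = EqF (s i) (s j)"
| "rename s (NegF p) = NegF (rename s p)"
| "rename s (ConF p q) = ConF (rename s p) (rename s q)"
| "rename s (AllF p) = AllF (rename (case_nat 0 (\<lambda>n. Suc (s n))) p)"

lemma sat_rename: "sat mem e (rename s p) \<longleftrightarrow> sat mem (\<lambda>n. e (s n)) p"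
proof (induction p arbitrary: e s)
  case (AllF p)
  have "(\<lambda>n. case_nat x e (case_nat 0 (\<lambda>n. Suc (s n)) n)) = case_nat x (\<lambda>n. e (s n))" for x
    by (auto split: nat.splits)
  then show ?case by (simp add: AllF)
qed simp_all

definition merge :: "(nat \<Rightarrow> 'a) \<Rightarrow> (nat \<Rightarrow> 'a) \<Rightarrow> nat \<Rightarrow> 'a" where
  "merge e c n = (if even n then e (n div 2) else c (n div 2))"

lemma merge_even: "merge e c (2 * k) = e k"
  and merge_odd: "merge e c (Suc (2 * k)) = c k"
  by (simp_all add: merge_def)

context set_structure
begin

text \<open>
  Even variables refer to the environment and odd ones to the parameters, so that parameters of
  several formulas can be collected in one sequence.
\<close>

definition definable :: "((nat \<Rightarrow> 'm) \<Rightarrow> bool) \<Rightarrow> bool" where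
  "definable P \<longleftrightarrow> (\<exists>p c. \<forall>e. P e \<longleftrightarrow> sat mem (merge e c) p)"

text \<open>The language has no function symbols, so a function is handled through its graph, with
  the value in variable 0; \<open>definable_subst\<close> then puts it into a predicate by
  quantifying over that value.\<close>

definition definable_fun :: "((nat \<Rightarrow> 'm) \<Rightarrow> 'm) \<Rightarrow> bool" where
  "definable_fun f \<longleftrightarrow> definable (\<lambda>e. e 0 = f (\<lambda>n. e (Suc n)))"

lemma definable_rename:
  assumes "definable P"
  shows "definable (\<lambda>e. P (\<lambda>n. e (s n)))"
proof -
  obtain p c where *: "\<And>e. P e \<longleftrightarrow> sat mem (merge e c) p"
    using assms unfolding definable_def by blast
  have "merge (\<lambda>n. e (s n)) c =
      (\<lambda>n. merge e c (if even n then 2 * s (n div 2) else n))" for e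
    by (auto simp: merge_def fun_eq_iff)
  then have "P (\<lambda>n. e (s n)) \<longleftrightarrow>
      sat mem (merge e c) (rename (\<lambda>n. if even n then 2 * s (n div 2) else n) p)" for e
    by (simp add: * sat_rename)
  then show ?thesis unfolding definable_def by blast
qed

lemma definable_not:
  assumes "definable P"
  shows "definable (\<lambda>e. \<not> P e)"
proof -
  obtain p c where *: "\<And>e. P e \<longleftrightarrow> sat mem (merge e c) p"
    using assms unfolding definable_def by blast
  then have "(\<not> P e) \<longleftrightarrow> sat mem (merge e c) (NegF p)" for e by simp
  then show ?thesis unfolding definable_def by blast
qed

lemma definable_conj:
  assumes "definable P" "definable Q"
  shows "definable (\<lambda>e. P e \<and> Q e)"
proof -
  obtain p c where p: "\<And>e. P e \<longleftrightarrow> sat mem (merge e c) p"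
    using assms(1) unfolding definable_def by blast
  obtain q d where q: "\<And>e. Q e \<longleftrightarrow> sat mem (merge e d) q"
    using assms(2) unfolding definable_def by blast
  \<comment> \<open>The parameter \<open>c k\<close> has index n = 2k+1 on the left. On the right
    the parameters alternate between \<open>c\<close> and \<open>d\<close>, so \<open>c k\<close> is
    at 4k+1 = 2n-1 and \<open>d k\<close> at 4k+3 = 2n+1.\<close>
  have "merge e c n = merge e (merge c d) (if even n then n else 2 * n - 1) \<and>
    merge e d n = merge e (merge c d) (if even n then n else 2 * n + 1)" for e n
  proof (cases "even n")
    case False
    then obtain k where k: "n = Suc (2 * k)" using oddE by fastforce
    then have *: "2 * n - 1 = Suc (2 * (2 * k))" "2 * n + 1 = Suc (2 * Suc (2 * k))" by simp_all
    have "merge e (merge c d) (2 * n - 1) = c k" "merge e (merge c d) (2 * n + 1) = d k"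
      unfolding * merge_odd merge_even by (rule refl)+
    with False show ?thesis by (simp add: k merge_odd)
  qed (simp add: merge_def)
  then have *: "merge e c = (\<lambda>n. merge e (merge c d) (if even n then n else 2 * n - 1))"
    "merge e d = (\<lambda>n. merge e (merge c d) (if even n then n else 2 * n + 1))" for e
    by blast+
  have "(P e \<and> Q e) \<longleftrightarrow> sat mem (merge e (merge c d))
      (ConF (rename (\<lambda>n. if even n then n else 2 * n - 1) p)
            (rename (\<lambda>n. if even n then n else 2 * n + 1) q))" for e
    unfolding p q sat.simps sat_rename *(1,2)[of e, symmetric] by (rule refl)
  then show ?thesis unfolding definable_def by blast
qed

lemma definable_all:
  assumes "definable (\<lambda>e. P (e 0) (\<lambda>n. e (Suc n)))"
  shows "definable (\<lambda>e. \<forall>x. P x e)"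
proof -
  obtain p c where *: "\<And>e. P (e 0) (\<lambda>n. e (Suc n)) \<longleftrightarrow> sat mem (merge e c) p"
    using assms unfolding definable_def by blast
  \<comment> \<open>Binding \<open>x\<close> shifts the even variables by two places but
    \<open>AllF\<close> shifts everything by one, whence +1 on odd and -1 on even indices. The
    truncated 0 - 1 = 0 sends the bound variable to itself.\<close>
  let ?s = "\<lambda>n. if odd n then Suc n else n - 1"
  have "merge (case_nat x e) c = (\<lambda>n. case_nat x (merge e c) (?s n))" for x e
  proof
    fix n show "merge (case_nat x e) c n = case_nat x (merge e c) (?s n)"
    proof (cases "odd n")
      case False
      then obtain m where "n = 2 * m" by blast
      then show ?thesis by (cases m) (auto simp: merge_def)
    qed (simp add: merge_def)
  qed
  then have "(\<forall>x. P x e) \<longleftrightarrow> sat mem (merge e c) (AllF (rename ?s p))" for e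
    using *[of "case_nat x e" for x] by (simp add: sat_rename)
  then show ?thesis unfolding definable_def by blast
qed

lemma definable_ex:
  assumes "definable (\<lambda>e. P (e 0) (\<lambda>n. e (Suc n)))"
  shows "definable (\<lambda>e. \<exists>x. P x e)"
proof -
  have "definable (\<lambda>e. \<not> (\<forall>x. \<not> P x e))"
    by (intro definable_not definable_all assms)
  then show ?thesis by simp
qed

lemma definable_imp:
  assumes "definable P" "definable Q"
  shows "definable (\<lambda>e. P e \<longrightarrow> Q e)"
proof -
  have "definable (\<lambda>e. \<not> (P e \<and> \<not> Q e))"
    by (intro definable_not definable_conj assms)
  then show ?thesis by simp
qed

lemma definable_disj:
  assumes "definable P" "definable Q"
  shows "definable (\<lambda>e. P e \<or> Q e)"
proof -
  have "definable (\<lambda>e. \<not> P e \<longrightarrow> Q e)"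
    by (intro definable_not definable_imp assms)
  then show ?thesis by (simp add: disj_imp)
qed

lemma definable_iff:
  assumes "definable P" "definable Q"
  shows "definable (\<lambda>e. P e \<longleftrightarrow> Q e)"
proof -
  have "definable (\<lambda>e. (P e \<longrightarrow> Q e) \<and> (Q e \<longrightarrow> P e))"
    by (intro definable_conj definable_imp assms)
  then show ?thesis by (simp add: iff_conv_conj_imp)
qed

lemma definable_False: "definable (\<lambda>e. False)"
proof -
  have "sat mem (merge e c) (ConF (EqF 0 0) (NegF (EqF 0 0))) \<longleftrightarrow> False" for e c
    by simp
  then show ?thesis unfolding definable_def by blast
qed

lemma definable_fun_var: "definable_fun (\<lambda>e. e k)"
proof -
  have "e 0 = e (Suc k) \<longleftrightarrow> sat mem (merge e c) (EqF 0 (2 * Suc k))" for e c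
    by (simp add: merge_def)
  then show ?thesis unfolding definable_fun_def definable_def by blast
qed

lemma definable_fun_const: "definable_fun (\<lambda>e. a)"
proof -
  have "e 0 = a \<longleftrightarrow> sat mem (merge e (\<lambda>_. a)) (EqF 0 1)" for e
    by (simp add: merge_def)
  then show ?thesis unfolding definable_fun_def definable_def by blast
qed

lemma definable_fun_rename:
  assumes "definable_fun f"
  shows "definable_fun (\<lambda>e. f (\<lambda>n. e (s n)))"
  using definable_rename[OF assms[unfolded definable_fun_def], of "case_nat 0 (\<lambda>n. Suc (s n))"]
  by (simp add: definable_fun_def)

lemma definable_subst:
  assumes f: "definable_fun f" and P: "definable (\<lambda>e. P (e 0) (\<lambda>n. e (Suc n)))"
  shows "definable (\<lambda>e. P (f e) e)"
proof -
  have "definable (\<lambda>e. \<exists>x. x = f e \<and> P x e)"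
    using f P unfolding definable_fun_def by (intro definable_ex definable_conj)
  then show ?thesis by simp
qed

lemma definable_mem_var: "definable (\<lambda>e. e i \<in>\<^sub>M e j)"
proof -
  have "e i \<in>\<^sub>M e j \<longleftrightarrow> sat mem (merge e c) (MemF (2 * i) (2 * j))" for e c
    by (simp add: merge_def)
  then show ?thesis unfolding definable_def by blast
qed

lemma definable_eq_var: "definable (\<lambda>e. e i = e j)"
proof -
  have "e i = e j \<longleftrightarrow> sat mem (merge e c) (EqF (2 * i) (2 * j))" for e c
    by (simp add: merge_def)
  then show ?thesis unfolding definable_def by blast
qed

lemma definable_subst2:
  assumes f: "definable_fun f" and g: "definable_fun g"
    and P: "definable (\<lambda>e. P (e 0) (e 1))"
  shows "definable (\<lambda>e. P (f e) (g e))"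
proof (rule definable_subst[OF f], rule definable_subst)
  show "definable_fun (\<lambda>e. g (\<lambda>n. e (Suc n)))"
    by (rule definable_fun_rename[OF g])
  show "definable (\<lambda>e. P (e (Suc 0)) (e 0))"
    using definable_rename[OF P, of "\<lambda>n. if n = 0 then 1 else 0"] by simp
qed

lemma definable_mem:
  "definable_fun f \<Longrightarrow> definable_fun g \<Longrightarrow> definable (\<lambda>e. f e \<in>\<^sub>M g e)"
  by (rule definable_subst2) (simp_all add: definable_mem_var)

lemma definable_eq:
  "definable_fun f \<Longrightarrow> definable_fun g \<Longrightarrow> definable (\<lambda>e. f e = g e)"
  by (rule definable_subst2) (simp_all add: definable_eq_var)

lemmas definable_intros =
  definable_not definable_conj definable_all definable_ex definable_imp definable_disj definable_iff
  definable_mem definable_eq definable_fun_var definable_fun_const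

lemma the_set:
  assumes "extensionality" "\<exists>z. \<forall>x. x \<in>\<^sub>M z \<longleftrightarrow> P x"
  shows "x \<in>\<^sub>M (THE z. \<forall>x. x \<in>\<^sub>M z \<longleftrightarrow> P x) \<longleftrightarrow> P x"
proof -
  obtain z where z: "\<forall>x. x \<in>\<^sub>M z \<longleftrightarrow> P x" using assms by blast
  then have "(THE z. \<forall>x. x \<in>\<^sub>M z \<longleftrightarrow> P x) = z"
    using assms(1) unfolding extensionality_def by (intro the_equality) auto
  with z show ?thesis by simp
qed

end

section \<open>Separation, pairs and Cantor's theorem inside the ground model\<close>

locale zf_structure = set_structure mem
  for mem :: "'m \<Rightarrow> 'm \<Rightarrow> bool"  (infix "\<in>\<^sub>M" 50) +
  assumes zf: "ZF"
begin

lemma extensional: "extensionality"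
  using zf by (simp add: ZF_def)

lemma separation:
  assumes "definable (\<lambda>e. P (e 0))"
  shows "\<exists>z. \<forall>x. x \<in>\<^sub>M z \<longleftrightarrow> x \<in>\<^sub>M a \<and> P x"
proof -
  obtain p c where *: "\<And>e. P (e 0) \<longleftrightarrow> sat mem (merge e c) p"
    using assms unfolding definable_def by blast
  have sep: "\<forall>p e a. \<exists>z. \<forall>x. x \<in>\<^sub>M z \<longleftrightarrow> x \<in>\<^sub>M a \<and> sat mem (case_nat x e) p"
    using zf by (simp add: ZF_def separation_scheme_def)
  \<comment> \<open>Entry 0 is dropped to make room for the element \<open>x\<close>; in the
    remaining variables, on which the predicate does not depend, \<open>a\<close> is a mere
    filler.\<close>
  define e where "e = (\<lambda>n. merge (\<lambda>_. a) c (Suc n))"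
  have "merge (\<lambda>n. if n = 0 then x else a) c = case_nat x e" for x
  proof
    fix n show "merge (\<lambda>n. if n = 0 then x else a) c n = case_nat x e n"
    proof (cases n)
      case (Suc m)
      then show ?thesis by (cases m) (auto simp: merge_def e_def)
    qed (simp add: merge_def)
  qed
  then have "P x \<longleftrightarrow> sat mem (case_nat x e) p" for x
    using *[of "\<lambda>n. if n = 0 then x else a"] by simp
  then show ?thesis using sep by simp
qed

lemma mem_zero [simp]: "\<not> x \<in>\<^sub>M zero"
proof -
  have "\<exists>z. \<forall>x. x \<in>\<^sub>M z \<longleftrightarrow> False"
    using separation[of "\<lambda>_. False"] definable_False by simp
  from the_set[OF extensional this] show ?thesis by (simp add: zero_def)
qed

lemma mem_upair [simp]: "x \<in>\<^sub>M upair a b \<longleftrightarrow> x = a \<or> x = b"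
  unfolding upair_def using zf by (intro the_set[OF extensional]) (simp add: ZF_def pairing_axiom_def)

lemma mem_powerset [simp]: "x \<in>\<^sub>M powerset a \<longleftrightarrow> x \<subseteq>\<^sub>M a"
  unfolding powerset_def using zf
  by (intro the_set[OF extensional]) (simp add: ZF_def powerset_axiom_def)

lemma mem_union [simp]: "x \<in>\<^sub>M union a b \<longleftrightarrow> x \<in>\<^sub>M a \<or> x \<in>\<^sub>M b"
  unfolding union_def
proof (rule the_set[OF extensional])
  obtain z where "\<forall>x. x \<in>\<^sub>M z \<longleftrightarrow> (\<exists>y. x \<in>\<^sub>M y \<and> y \<in>\<^sub>M upair a b)"
    using zf unfolding ZF_def union_axiom_def by blast
  then show "\<exists>z. \<forall>x. x \<in>\<^sub>M z \<longleftrightarrow> x \<in>\<^sub>M a \<or> x \<in>\<^sub>M b" by auto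
qed

lemma set_eqI: "(\<And>x. x \<in>\<^sub>M a \<longleftrightarrow> x \<in>\<^sub>M b) \<Longrightarrow> a = b"
  using extensional unfolding extensionality_def by blast

lemma upair_eq_iff: "upair a b = upair c d \<longleftrightarrow> a = c \<and> b = d \<or> a = d \<and> b = c"
proof
  assume "upair a b = upair c d"
  then have "x = a \<or> x = b \<longleftrightarrow> x = c \<or> x = d" for x
    using mem_upair by metis
  then show "a = c \<and> b = d \<or> a = d \<and> b = c" by metis
qed (auto intro: set_eqI)

lemma pair_eq_iff [simp]: "pair a b = pair c d \<longleftrightarrow> a = c \<and> b = d"
  by (auto simp: pair_def upair_eq_iff)

lemma definable_fun_upair:
  assumes "definable_fun f" "definable_fun g"
  shows "definable_fun (\<lambda>e. upair (f e) (g e))"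
proof -
  have *: "z = upair a b \<longleftrightarrow> (\<forall>x. x \<in>\<^sub>M z \<longleftrightarrow> x = a \<or> x = b)" for z a b
    by (auto intro: set_eqI)
  show ?thesis unfolding definable_fun_def *
    by (intro definable_intros assms[THEN definable_fun_rename, of "\<lambda>n. Suc (Suc n)"])
qed

lemma definable_fun_pair:
  "definable_fun f \<Longrightarrow> definable_fun g \<Longrightarrow> definable_fun (\<lambda>e. pair (f e) (g e))"
  unfolding pair_def by (intro definable_fun_upair)

lemma mem_cart [simp]: "p \<in>\<^sub>M cart a b \<longleftrightarrow> (\<exists>x y. x \<in>\<^sub>M a \<and> y \<in>\<^sub>M b \<and> p = pair x y)"
  unfolding cart_def
proof (rule the_set[OF extensional])
  have "definable (\<lambda>e. \<exists>x y. x \<in>\<^sub>M a \<and> y \<in>\<^sub>M b \<and> e 0 = pair x y)"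
    by (intro definable_intros definable_fun_pair)
  from separation[OF this, of "powerset (powerset (union a b))"]
  obtain z where z: "\<forall>p. p \<in>\<^sub>M z \<longleftrightarrow> p \<in>\<^sub>M powerset (powerset (union a b)) \<and>
      (\<exists>x y. x \<in>\<^sub>M a \<and> y \<in>\<^sub>M b \<and> p = pair x y)" by blast
  have "pair x y \<in>\<^sub>M powerset (powerset (union a b))" if "x \<in>\<^sub>M a" "y \<in>\<^sub>M b" for x y
    using that by (auto simp: pair_def sub_def)
  then show "\<exists>z. \<forall>p. p \<in>\<^sub>M z \<longleftrightarrow> (\<exists>x y. x \<in>\<^sub>M a \<and> y \<in>\<^sub>M b \<and> p = pair x y)"
    using z by metis
qed

lemma mem_two: "x \<in>\<^sub>M two \<longleftrightarrow> x = zero \<or> x = one"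
  by (auto simp: two_def one_def succ_def intro: set_eqI)

lemma app_mem:
  assumes "is_fun f a b" "x \<in>\<^sub>M a"
  shows "pair x y \<in>\<^sub>M f \<longleftrightarrow> app f x = y" "app f x \<in>\<^sub>M b"
proof -
  have "\<exists>!y. pair x y \<in>\<^sub>M f" using assms by (simp add: is_fun_def)
  then show *: "pair x y \<in>\<^sub>M f \<longleftrightarrow> app f x = y" for y
    unfolding app_def using theI'[of "\<lambda>y. pair x y \<in>\<^sub>M f"] by blast
  have "pair x (app f x) \<in>\<^sub>M cart a b"
    using assms * unfolding is_fun_def sub_def by blast
  then show "app f x \<in>\<^sub>M b" by auto
qed

text \<open>Cantor's diagonal argument for a partial function that is only a definable class:
  \<open>Q w q\<close> says that \<open>q\<close> is sent to \<open>w\<close>, and \<open>h\<close>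
  names the elements of \<open>a\<close> by those of \<open>k\<close>. The diagonal set
  \<open>d\<close> collects the names that are not in the set assigned to what they name.\<close>

lemma no_surjection_to_powerset:
  assumes bij: "is_bij h k a" and Q: "definable (\<lambda>e. Q (e 0) (e 1))"
    and det: "\<And>w w' q. Q w q \<Longrightarrow> Q w' q \<Longrightarrow> w = w'"
    and dom: "\<And>w q. Q w q \<Longrightarrow> q \<in>\<^sub>M a"
  shows "\<exists>w. w \<in>\<^sub>M powerset k \<and> (\<forall>q. \<not> Q w q)"
proof (rule ccontr)
  assume "\<not> ?thesis"
  then have onto: "\<exists>q. Q w q" if "w \<in>\<^sub>M powerset k" for w using that by blast
  have "definable (\<lambda>e. \<exists>q w. Q w q \<and> pair (e 0) q \<in>\<^sub>M h \<and> \<not> e 0 \<in>\<^sub>M w)"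
    by (intro definable_intros definable_fun_pair) (use Q in simp)
  from separation[OF this, of k] obtain d where
    d: "\<And>x. x \<in>\<^sub>M d \<longleftrightarrow> x \<in>\<^sub>M k \<and> (\<exists>q w. Q w q \<and> pair x q \<in>\<^sub>M h \<and> \<not> x \<in>\<^sub>M w)"
    by blast
  then obtain q where q: "Q d q" using onto[of d] by (auto simp: sub_def)
  then obtain x where x: "pair x q \<in>\<^sub>M h"
    using bij dom unfolding is_bij_def by blast
  then have "pair x q \<in>\<^sub>M cart k a"
    using bij unfolding is_bij_def is_fun_def sub_def by blast
  then have "x \<in>\<^sub>M k" by auto
  then have "q' = q" if "pair x q' \<in>\<^sub>M h" for q'
    using that x bij unfolding is_bij_def is_fun_def by blast
  then show False using d[of x] \<open>x \<in>\<^sub>M k\<close> q x det by blast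
qed

end

section \<open>Definable families of formulas\<close>

locale zf_realizability = zf_structure mem + realizability_model mem A
  for mem :: "'m \<Rightarrow> 'm \<Rightarrow> bool"  (infix "\<in>\<^sub>M" 50) and A :: "'m realizability_structure" +
  assumes algebra: "realizability_algebra"
begin

lemma
  shows Apply_fun: "is_fun (Apply A) (cart (Terms A) (Terms A)) (Terms A)"
    and Push_fun: "is_fun (Push A) (cart (Terms A) (Stacks A)) (Stacks A)"
    and Star_fun: "is_fun (Star A) (cart (Terms A) (Stacks A)) (Processes A)"
    and Cont_fun: "is_fun (Cont A) (Stacks A) (Terms A)"
  using algebra by (simp_all add: realizability_algebra_def)

lemma is_term_ap [simp]: "is_term x \<Longrightarrow> is_term y \<Longrightarrow> is_term (ap x y)"
  unfolding ap_def by (rule app_mem(2)[OF Apply_fun]) simp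

lemma is_stack_push [simp]: "is_term x \<Longrightarrow> is_stack p \<Longrightarrow> is_stack (x \<^bold>\<cdot> p)"
  unfolding push_def by (rule app_mem(2)[OF Push_fun]) simp

lemma is_term_cont [simp]: "is_stack p \<Longrightarrow> is_term (cont p)"
  unfolding cont_def by (rule app_mem(2)[OF Cont_fun])

lemma falsity_is_stack: "p \<in> falsity F \<Longrightarrow> is_stack p"
proof (induction F arbitrary: p)
  case (NotIn a b)
  then obtain t S N where rec: "falsity_rec t S N" "a \<in>\<^sub>M t" "b \<in>\<^sub>M t" and
    p: "pair (pair a b) p \<in>\<^sub>M N" by auto
  have "\<exists>u u' q. is_term u \<and> is_term u' \<and> is_stack q \<and> p = u \<^bold>\<cdot> u' \<^bold>\<cdot> q"
    using rec p unfolding falsity_rec_def by meson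
  then show ?case by auto
next
  case (Incl a b)
  then obtain t S N where rec: "falsity_rec t S N" "a \<in>\<^sub>M t" "b \<in>\<^sub>M t" and
    p: "pair (pair a b) p \<in>\<^sub>M S" by auto
  have "\<exists>u q. is_term u \<and> is_stack q \<and> p = u \<^bold>\<cdot> q"
    using rec p unfolding falsity_rec_def by meson
  then show ?case by auto
qed (auto split: if_splits)

lemma push_eq_iff:
  "is_term x \<Longrightarrow> is_stack p \<Longrightarrow> x \<^bold>\<cdot> p = q \<longleftrightarrow> pair (pair x p) q \<in>\<^sub>M Push A"
  unfolding push_def by (subst app_mem(1)[OF Push_fun]) auto

lemma star_mem_Pole_iff:
  "is_term x \<Longrightarrow> is_stack p \<Longrightarrow>
    x \<star> p \<in>\<^sub>M Pole A \<longleftrightarrow> (\<exists>z. z \<in>\<^sub>M Pole A \<and> pair (pair x p) z \<in>\<^sub>M Star A)"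
  unfolding star_def by (subst app_mem(1)[OF Star_fun]) auto

text \<open>Values of the operations are replaced by membership in their graphs
  \<open>Push A\<close> and \<open>Star A\<close>, which turns the clause for implication into a
  set-theoretic formula with parameters.\<close>

lemma falsity_Imp_iff:
  "q \<in> falsity (F \<^bold>\<rightarrow> G) \<longleftrightarrow> (\<exists>x p. is_term x \<and> p \<in> falsity G \<and> pair (pair x p) q \<in>\<^sub>M Push A \<and>
    (\<forall>p'. p' \<in> falsity F \<longrightarrow> (\<exists>z. z \<in>\<^sub>M Pole A \<and> pair (pair x p') z \<in>\<^sub>M Star A)))"
proof -
  have "q \<in> falsity (F \<^bold>\<rightarrow> G) \<longleftrightarrow> (\<exists>x p. is_term x \<and> p \<in> falsity G \<and> x \<^bold>\<cdot> p = q \<and>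
      (\<forall>p'. p' \<in> falsity F \<longrightarrow> x \<star> p' \<in>\<^sub>M Pole A))"
    by auto
  then show ?thesis
    by (simp add: star_mem_Pole_iff push_eq_iff falsity_is_stack cong: conj_cong)
qed

text \<open>\<open>falsity\<close> is a recursion outside the ground model; this is the condition
  under which its values can be collected by separation inside.\<close>

definition definable_family :: "((nat \<Rightarrow> 'm) \<Rightarrow> 'm zfe) \<Rightarrow> bool" where
  "definable_family F \<longleftrightarrow> definable (\<lambda>e. e 0 \<in> falsity (F (\<lambda>n. e (Suc n))))"

lemma definable_family_rename:
  assumes "definable_family F"
  shows "definable (\<lambda>e. e k \<in> falsity (F (\<lambda>n. e (s n))))"
  using definable_rename[OF assms[unfolded definable_family_def], of "case_nat k s"] by simp

lemma definable_family_Bot: "definable_family (\<lambda>e. Bot)"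
  unfolding definable_family_def by (simp, intro definable_intros)

lemma definable_family_NotEps:
  assumes "definable_fun f" "definable_fun g"
  shows "definable_family (\<lambda>e. NotEps (f e) (g e))"
  unfolding definable_family_def falsity.simps mem_Collect_eq
  by (intro definable_intros definable_fun_pair assms[THEN definable_fun_rename, of Suc])

lemma definable_family_Neq:
  assumes "definable_fun f" "definable_fun g"
  shows "definable_family (\<lambda>e. Neq (f e) (g e))"
proof -
  have *: "p \<in> falsity (Neq a b) \<longleftrightarrow> a = b \<and> is_stack p" for p a b by simp
  show ?thesis
    unfolding definable_family_def *
    by (intro definable_intros assms[THEN definable_fun_rename, of Suc])
qed

lemma definable_family_Imp:
  assumes "definable_family F" "definable_family G"
  shows "definable_family (\<lambda>e. F e \<^bold>\<rightarrow> G e)"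
  unfolding definable_family_def falsity_Imp_iff
  by (intro definable_intros definable_fun_pair
      definable_family_rename[OF assms(1), of 0 "\<lambda>n. Suc (Suc (Suc (Suc n)))"]
      definable_family_rename[OF assms(2), of 0 "\<lambda>n. Suc (Suc (Suc n))"])

lemma definable_family_Forall:
  assumes "definable_family (\<lambda>e. F (e 0) (\<lambda>n. e (Suc n)))"
  shows "definable_family (\<lambda>e. Forall (\<lambda>x. F x e))"
proof -
  have *: "p \<in> falsity (Forall H) \<longleftrightarrow> (\<exists>x. p \<in> falsity (H x))" for p H by simp
  show ?thesis
    unfolding definable_family_def *
    using definable_family_rename[OF assms, of 1 "case_nat 0 (\<lambda>n. Suc (Suc n))"]
    by (intro definable_intros) simp
qed

lemma definable_family_ForallGimel:
  assumes "definable_family (\<lambda>e. F (e 0) (\<lambda>n. e (Suc n)))"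
  shows "definable_family (\<lambda>e. ForallGimel X (\<lambda>x. F x e))"
proof -
  have *: "p \<in> falsity (ForallGimel X H) \<longleftrightarrow> (\<exists>x. x \<in>\<^sub>M X \<and> p \<in> falsity (H x))" for p H
    by auto
  show ?thesis
    unfolding definable_family_def *
    using definable_family_rename[OF assms, of 1 "case_nat 0 (\<lambda>n. Suc (Suc n))"]
    by (intro definable_intros) simp
qed

lemmas definable_family_intros =
  definable_family_Bot definable_family_NotEps definable_family_Neq definable_family_Imp
  definable_family_Forall definable_family_ForallGimel
  definable_fun_var definable_fun_const definable_fun_pair

text \<open>The falsity value of \<open>NotEps u g\<close> is read off from \<open>g\<close>, so it
  can be prescribed for every \<open>u\<close> by collecting the pairs of an element and a stack.
  The result is an equality of falsity values: \<open>NotEps u g\<close> and \<open>F u\<close> have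
  the same realizers, and no term is spent on the translation.\<close>

lemma comprehension:
  assumes "definable_family (\<lambda>e. F (e 0))"
  shows "\<exists>g. \<forall>u. falsity (NotEps u g) = (if u \<in>\<^sub>M X then falsity (F u) else {})"
proof -
  have "definable (\<lambda>e. \<exists>u p. e 0 = pair u p \<and> p \<in> falsity (F u))"
    using definable_family_rename[OF assms, of 0 Suc]
    by (intro definable_intros definable_fun_pair)
  from separation[OF this, of "cart X (Stacks A)"] obtain g where
    "\<And>q. q \<in>\<^sub>M g \<longleftrightarrow> q \<in>\<^sub>M cart X (Stacks A) \<and> (\<exists>u p. q = pair u p \<and> p \<in> falsity (F u))"
    by blast
  then have "falsity (NotEps u g) = (if u \<in>\<^sub>M X then falsity (F u) else {})" for u
    using falsity_is_stack by auto
  then show ?thesis by blast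
qed

end

section \<open>Realizers from lambda terms\<close>

datatype lterm = V nat | Ap lterm lterm  (infixl "\<bullet>" 80) | TB | TC | TI | TK | TW | TCC

text \<open>Sequencing in continuation-passing style: on x, y, f the term runs \<open>s\<close> on x
  with continuation (t y) f.\<close>

definition chain :: "lterm \<Rightarrow> lterm \<Rightarrow> lterm" where
  "chain s t = TC \<bullet> (TB \<bullet> TB \<bullet> (TB \<bullet> TB \<bullet> s)) \<bullet> t"

text \<open>
  \<open>pass n t\<close> takes a value for the variable \<open>n\<close> and a function, and calls the function on exactly the
  corresponding instance of \<open>t\<close>, so that abstraction by \<open>Lam\<close> reproduces instances literally and not
  only up to execution.
\<close>

primrec pass :: "nat \<Rightarrow> lterm \<Rightarrow> lterm" where
  "pass n (V m) = (if m = n then TC \<bullet> TI else TK \<bullet> (TC \<bullet> TI \<bullet> V m))"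
| "pass n (s \<bullet> t) = TW \<bullet> chain (pass n s) (chain (pass n t) TB)"
| "pass n TB = TK \<bullet> (TC \<bullet> TI \<bullet> TB)"
| "pass n TC = TK \<bullet> (TC \<bullet> TI \<bullet> TC)"
| "pass n TI = TK \<bullet> (TC \<bullet> TI \<bullet> TI)"
| "pass n TK = TK \<bullet> (TC \<bullet> TI \<bullet> TK)"
| "pass n TW = TK \<bullet> (TC \<bullet> TI \<bullet> TW)"
| "pass n TCC = TK \<bullet> (TC \<bullet> TI \<bullet> TCC)"

text \<open>The result contains no \<open>V n\<close>. Hence numbers may be reused freely: the named
  terms below are closed, and no surrounding abstraction can interfere with one nested in
  another.\<close>

definition Lam :: "nat \<Rightarrow> lterm \<Rightarrow> lterm" where
  "Lam n t = TC \<bullet> pass n t \<bullet> TI"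

definition Fst :: lterm where
  "Fst = Lam 0 (TCC \<bullet> Lam 1 (V 0 \<bullet> Lam 2 (Lam 3 (V 1 \<bullet> V 2))))"

definition Snd :: lterm where
  "Snd = Lam 0 (TCC \<bullet> Lam 1 (V 0 \<bullet> Lam 2 (Lam 3 (V 1 \<bullet> V 3))))"

definition Pair :: lterm where
  "Pair = Lam 0 (Lam 1 (Lam 2 (V 2 \<bullet> V 0 \<bullet> V 1)))"

definition Escape :: lterm where
  "Escape = Lam 0 (Lam 1 (Lam 2 (TCC \<bullet> Lam 3 (V 0 \<bullet> (TCC \<bullet> V 3) \<bullet> (TCC \<bullet> V 3) \<bullet> V 1 \<bullet> V 2))))"

definition Ind :: lterm where
  "Ind = Lam 0 (Lam 1 (TCC \<bullet> Lam 2 (V 0 \<bullet> TI \<bullet> Lam 3 (V 3 \<bullet> V 2) \<bullet> Lam 4 (V 4 \<bullet>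
    Lam 5 (Lam 6 (V 5 \<bullet> (V 1 \<bullet> Lam 7 (TCC \<bullet> Lam 8 (V 7 \<bullet> (V 6 \<bullet> V 8))))))))))"

definition Well_order :: lterm where
  "Well_order = Lam 0 (Lam 1 (V 0 \<bullet> Lam 2 (Lam 3 (V 3 \<bullet> Lam 4 (Lam 5 (V 5 \<bullet>
    Lam 6 (Lam 7 (V 1 \<bullet> (V 4 \<bullet> TI \<bullet> TI \<bullet> TI) \<bullet> (V 6 \<bullet> TI \<bullet> TI) \<bullet> V 7))))))))"

definition Transfer :: lterm where
  "Transfer = Lam 0 (Lam 1 (Lam 2 (Lam 3 (V 1 \<bullet> V 2 \<bullet> (V 0 \<bullet> V 2 \<bullet> V 3)))))"

definition Half :: lterm where
  "Half = Lam 0 (Lam 1 (Lam 2 (Lam 3 (Lam 4 (Lam 5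
    (V 4 \<bullet> V 2 \<bullet> (Transfer \<bullet> Lam 6 (V 1 \<bullet> V 6 \<bullet> (V 0 \<bullet> V 6 \<bullet> V 2)) \<bullet> (V 3 \<bullet> V 2 \<bullet> V 5))))))))"

definition Agree_step :: lterm where
  "Agree_step = Lam 0 (Lam 1 (Lam 2 (Lam 3 (Lam 4 (Lam 5 (Lam 6 (Pair \<bullet>
    (Half \<bullet> V 0 \<bullet> Lam 7 (Lam 8 (Snd \<bullet> (V 5 \<bullet> V 7 \<bullet> V 8))) \<bullet> V 6 \<bullet> V 1 \<bullet> V 4) \<bullet>
    (Half \<bullet> V 0 \<bullet> Lam 7 (Lam 8 (Fst \<bullet> (V 5 \<bullet> V 7 \<bullet> V 8))) \<bullet> V 6 \<bullet> V 3 \<bullet> V 2))))))))"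

definition Agree :: lterm where
  "Agree = Lam 0 (Lam 1 (Lam 2 (Lam 3 (Lam 4 (Lam 5
    (Ind \<bullet> V 1 \<bullet> (Agree_step \<bullet> V 0 \<bullet> V 2 \<bullet> V 3 \<bullet> V 4 \<bullet> V 5)))))))"

definition Kernel_step :: lterm where
  "Kernel_step = Lam 0 (Lam 1 (Lam 2 (Lam 3 (Pair \<bullet> Lam 4 (V 4 \<bullet> V 2 \<bullet> V 3) \<bullet>
    Lam 4 (Lam 5 (Lam 6 (Transfer \<bullet>
      Lam 7 (Fst \<bullet> (Agree \<bullet> V 0 \<bullet> V 1 \<bullet> V 5 \<bullet> V 6 \<bullet> V 2 \<bullet> V 3 \<bullet> V 7)) \<bullet> V 4)))))))"

definition Kernel :: lterm where
  "Kernel = Lam 0 (Lam 1 (Ind \<bullet> V 1 \<bullet> Lam 2 (Kernel_step \<bullet> V 0 \<bullet> V 1 \<bullet>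
    Lam 3 (Fst \<bullet> (V 2 \<bullet> V 3)) \<bullet> Lam 3 (Snd \<bullet> (V 2 \<bullet> V 3)))))"

definition Matching :: lterm where
  "Matching = Lam 0 (Lam 1 (Lam 2 (Lam 3 (Lam 4 (Lam 5 (Fst \<bullet> V 1 \<bullet> V 2 \<bullet>
    (V 0 \<bullet> V 4 \<bullet> (TCC \<bullet> Lam 6 (Fst \<bullet> V 1 \<bullet> V 3 \<bullet> V 6 \<bullet> V 2 \<bullet> V 5))) \<bullet> V 3 \<bullet> V 5))))))"

definition Unmatched :: lterm where
  "Unmatched = Lam 0 (Lam 1 (Lam 2 (V 2 \<bullet> (Snd \<bullet> V 0 \<bullet>
    Lam 3 (Lam 4 (Lam 5 (V 5 \<bullet> (V 1 \<bullet> V 4) \<bullet> (V 2 \<bullet> V 4))))))))"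

definition Contradiction :: lterm where
  "Contradiction = Lam 0 (Lam 1 (Lam 2 (Lam 3 (Lam 4 (Unmatched \<bullet> (Kernel \<bullet> V 2 \<bullet> V 4) \<bullet>
    (Escape \<bullet> (Matching \<bullet> V 3 \<bullet> (Kernel \<bullet> V 2 \<bullet> V 4)) \<bullet> V 0 \<bullet> (TK \<bullet> TI)) \<bullet>
    (Escape \<bullet> (Matching \<bullet> V 3 \<bullet> (Kernel \<bullet> V 2 \<bullet> V 4)) \<bullet> V 1 \<bullet> TK))))))"

definition Not_well_orderable :: lterm where
  "Not_well_orderable =
    Lam 0 (Lam 1 (Lam 2 (V 2 \<bullet> Lam 3 (Well_order \<bullet> V 3 \<bullet> (Contradiction \<bullet> V 0 \<bullet> V 1)))))"

section \<open>Execution of lambda terms\<close>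

context zf_realizability
begin

primrec ev :: "(nat \<Rightarrow> 'm) \<Rightarrow> lterm \<Rightarrow> 'm" where
  "ev s (V n) = s n"
| "ev s (t \<bullet> u) = ap (ev s t) (ev s u)"
| "ev s TB = InsB A"
| "ev s TC = InsC A"
| "ev s TI = InsI A"
| "ev s TK = InsK A"
| "ev s TW = InsW A"
| "ev s TCC = InsCC A"

lemma ProofLike_ins [simp]:
  "InsB A \<in>\<^sub>M ProofLike A" "InsC A \<in>\<^sub>M ProofLike A" "InsI A \<in>\<^sub>M ProofLike A"
  "InsK A \<in>\<^sub>M ProofLike A" "InsW A \<in>\<^sub>M ProofLike A" "InsCC A \<in>\<^sub>M ProofLike A"
  using algebra by (simp_all add: realizability_algebra_def)

lemma ProofLike_is_term: "x \<in>\<^sub>M ProofLike A \<Longrightarrow> is_term x"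
  using algebra by (simp add: realizability_algebra_def sub_def)

lemma is_term_ins [simp]:
  "is_term (InsB A)" "is_term (InsC A)" "is_term (InsI A)"
  "is_term (InsK A)" "is_term (InsW A)" "is_term (InsCC A)"
  by (simp_all add: ProofLike_is_term)

lemma ProofLike_ap:
  "x \<in>\<^sub>M ProofLike A \<Longrightarrow> y \<in>\<^sub>M ProofLike A \<Longrightarrow> ap x y \<in>\<^sub>M ProofLike A"
  using algebra by (simp add: realizability_algebra_def)

lemma ev_ProofLike: "(\<And>n. s n \<in>\<^sub>M ProofLike A) \<Longrightarrow> ev s t \<in>\<^sub>M ProofLike A"
  by (induction t) (simp_all add: ProofLike_ap)

definition env :: "(nat \<Rightarrow> 'm) \<Rightarrow> bool" where
  "env s \<longleftrightarrow> (\<forall>n. is_term (s n))"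

lemma env_upd [simp]: "env s \<Longrightarrow> is_term x \<Longrightarrow> env (s(n := x))"
  by (simp add: env_def)

lemma is_term_env [simp]: "env s \<Longrightarrow> is_term (s n)"
  by (simp add: env_def)

lemma is_term_ev [simp]: "env s \<Longrightarrow> is_term (ev s t)"
  by (induction t) simp_all

lemma
  shows Pole_ap: "\<lbrakk>is_term x; is_term y; is_stack p; x \<star> y \<^bold>\<cdot> p \<in>\<^sub>M Pole A\<rbrakk>
      \<Longrightarrow> ap x y \<star> p \<in>\<^sub>M Pole A"
    and Pole_I: "\<lbrakk>is_term x; is_stack p; x \<star> p \<in>\<^sub>M Pole A\<rbrakk>
      \<Longrightarrow> InsI A \<star> x \<^bold>\<cdot> p \<in>\<^sub>M Pole A"
    and Pole_K: "\<lbrakk>is_term x; is_term y; is_stack p; x \<star> p \<in>\<^sub>M Pole A\<rbrakk>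
      \<Longrightarrow> InsK A \<star> x \<^bold>\<cdot> y \<^bold>\<cdot> p \<in>\<^sub>M Pole A"
    and Pole_W: "\<lbrakk>is_term x; is_term y; is_stack p; x \<star> y \<^bold>\<cdot> y \<^bold>\<cdot> p \<in>\<^sub>M Pole A\<rbrakk>
      \<Longrightarrow> InsW A \<star> x \<^bold>\<cdot> y \<^bold>\<cdot> p \<in>\<^sub>M Pole A"
    and Pole_C: "\<lbrakk>is_term x; is_term y; is_term z; is_stack p; x \<star> z \<^bold>\<cdot> y \<^bold>\<cdot> p \<in>\<^sub>M Pole A\<rbrakk>
      \<Longrightarrow> InsC A \<star> x \<^bold>\<cdot> y \<^bold>\<cdot> z \<^bold>\<cdot> p \<in>\<^sub>M Pole A"
    and Pole_B: "\<lbrakk>is_term x; is_term y; is_term z; is_stack p; x \<star> ap y z \<^bold>\<cdot> p \<in>\<^sub>M Pole A\<rbrakk>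
      \<Longrightarrow> InsB A \<star> x \<^bold>\<cdot> y \<^bold>\<cdot> z \<^bold>\<cdot> p \<in>\<^sub>M Pole A"
    and Pole_cc: "\<lbrakk>is_term x; is_stack p; x \<star> cont p \<^bold>\<cdot> p \<in>\<^sub>M Pole A\<rbrakk>
      \<Longrightarrow> InsCC A \<star> x \<^bold>\<cdot> p \<in>\<^sub>M Pole A"
    and Pole_cont: "\<lbrakk>is_term x; is_stack p; is_stack q; x \<star> p \<in>\<^sub>M Pole A\<rbrakk>
      \<Longrightarrow> cont p \<star> x \<^bold>\<cdot> q \<in>\<^sub>M Pole A"
proof -
  have Pole: "p \<in>\<^sub>M Pole A" if "p \<succ> q" "q \<in>\<^sub>M Pole A" for p q
    using algebra that unfolding realizability_algebra_def by blast
  have e: "\<forall>x y p. is_term x \<and> is_term y \<and> is_stack p \<longrightarrow>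
      ap x y \<star> p \<succ> x \<star> y \<^bold>\<cdot> p"
    using algebra unfolding realizability_algebra_def by (elim conjE)
  show "\<lbrakk>is_term x; is_term y; is_stack p; x \<star> y \<^bold>\<cdot> p \<in>\<^sub>M Pole A\<rbrakk>
      \<Longrightarrow> ap x y \<star> p \<in>\<^sub>M Pole A" for x y p
    by (rule Pole[OF e[rule_format]]) (intro conjI)
  have e: "\<forall>x p. is_term x \<and> is_stack p \<longrightarrow>
      InsI A \<star> x \<^bold>\<cdot> p \<succ> x \<star> p"
    using algebra unfolding realizability_algebra_def by (elim conjE)
  show "\<lbrakk>is_term x; is_stack p; x \<star> p \<in>\<^sub>M Pole A\<rbrakk>
      \<Longrightarrow> InsI A \<star> x \<^bold>\<cdot> p \<in>\<^sub>M Pole A" for x p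
    by (rule Pole[OF e[rule_format]]) (intro conjI)
  have e: "\<forall>x y p. is_term x \<and> is_term y \<and> is_stack p \<longrightarrow>
      InsK A \<star> x \<^bold>\<cdot> y \<^bold>\<cdot> p \<succ> x \<star> p"
    using algebra unfolding realizability_algebra_def by (elim conjE)
  show "\<lbrakk>is_term x; is_term y; is_stack p; x \<star> p \<in>\<^sub>M Pole A\<rbrakk>
      \<Longrightarrow> InsK A \<star> x \<^bold>\<cdot> y \<^bold>\<cdot> p \<in>\<^sub>M Pole A" for x y p
    by (rule Pole[OF e[rule_format]]) (intro conjI)
  have e: "\<forall>x y p. is_term x \<and> is_term y \<and> is_stack p \<longrightarrow>
      InsW A \<star> x \<^bold>\<cdot> y \<^bold>\<cdot> p \<succ> x \<star> y \<^bold>\<cdot> y \<^bold>\<cdot> p"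
    using algebra unfolding realizability_algebra_def by (elim conjE)
  show "\<lbrakk>is_term x; is_term y; is_stack p; x \<star> y \<^bold>\<cdot> y \<^bold>\<cdot> p \<in>\<^sub>M Pole A\<rbrakk>
      \<Longrightarrow> InsW A \<star> x \<^bold>\<cdot> y \<^bold>\<cdot> p \<in>\<^sub>M Pole A" for x y p
    by (rule Pole[OF e[rule_format]]) (intro conjI)
  have e: "\<forall>x y z p. is_term x \<and> is_term y \<and> is_term z \<and> is_stack p \<longrightarrow>
      InsC A \<star> x \<^bold>\<cdot> y \<^bold>\<cdot> z \<^bold>\<cdot> p \<succ> x \<star> z \<^bold>\<cdot> y \<^bold>\<cdot> p"
    using algebra unfolding realizability_algebra_def by (elim conjE)
  show "\<lbrakk>is_term x; is_term y; is_term z; is_stack p; x \<star> z \<^bold>\<cdot> y \<^bold>\<cdot> p \<in>\<^sub>M Pole A\<rbrakk>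
      \<Longrightarrow> InsC A \<star> x \<^bold>\<cdot> y \<^bold>\<cdot> z \<^bold>\<cdot> p \<in>\<^sub>M Pole A" for x y z p
    by (rule Pole[OF e[rule_format]]) (intro conjI)
  have e: "\<forall>x y z p. is_term x \<and> is_term y \<and> is_term z \<and> is_stack p \<longrightarrow>
      InsB A \<star> x \<^bold>\<cdot> y \<^bold>\<cdot> z \<^bold>\<cdot> p \<succ> x \<star> ap y z \<^bold>\<cdot> p"
    using algebra unfolding realizability_algebra_def by (elim conjE)
  show "\<lbrakk>is_term x; is_term y; is_term z; is_stack p; x \<star> ap y z \<^bold>\<cdot> p \<in>\<^sub>M Pole A\<rbrakk>
      \<Longrightarrow> InsB A \<star> x \<^bold>\<cdot> y \<^bold>\<cdot> z \<^bold>\<cdot> p \<in>\<^sub>M Pole A" for x y z p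
    by (rule Pole[OF e[rule_format]]) (intro conjI)
  have e: "\<forall>x p. is_term x \<and> is_stack p \<longrightarrow>
      InsCC A \<star> x \<^bold>\<cdot> p \<succ> x \<star> cont p \<^bold>\<cdot> p"
    using algebra unfolding realizability_algebra_def by (elim conjE)
  show "\<lbrakk>is_term x; is_stack p; x \<star> cont p \<^bold>\<cdot> p \<in>\<^sub>M Pole A\<rbrakk>
      \<Longrightarrow> InsCC A \<star> x \<^bold>\<cdot> p \<in>\<^sub>M Pole A" for x p
    by (rule Pole[OF e[rule_format]]) (intro conjI)
  have e: "\<forall>x p q. is_term x \<and> is_stack p \<and> is_stack q \<longrightarrow>
      cont p \<star> x \<^bold>\<cdot> q \<succ> x \<star> p"
    using algebra unfolding realizability_algebra_def by (elim conjE)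
  show "\<lbrakk>is_term x; is_stack p; is_stack q; x \<star> p \<in>\<^sub>M Pole A\<rbrakk>
      \<Longrightarrow> cont p \<star> x \<^bold>\<cdot> q \<in>\<^sub>M Pole A" for x p q
    by (rule Pole[OF e[rule_format]]) (intro conjI)
qed

lemmas Pole_rules = Pole_ap Pole_I Pole_K Pole_W Pole_C Pole_B

lemma Pole_chain:
  assumes "env s" "is_term x" "is_term y" "is_term f" "is_stack p"
    "ev s t \<star> x \<^bold>\<cdot> ap (ap (ev s u) y) f \<^bold>\<cdot> p \<in>\<^sub>M Pole A"
  shows "ev s (chain t u) \<star> x \<^bold>\<cdot> y \<^bold>\<cdot> f \<^bold>\<cdot> p \<in>\<^sub>M Pole A"
  unfolding chain_def ev.simps by (intro Pole_rules) (use assms in simp_all)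

lemma Pole_const:
  assumes "is_term c" "is_term x" "is_term f" "is_stack p" "f \<star> c \<^bold>\<cdot> p \<in>\<^sub>M Pole A"
  shows "ap (InsK A) (ap (ap (InsC A) (InsI A)) c) \<star> x \<^bold>\<cdot> f \<^bold>\<cdot> p \<in>\<^sub>M Pole A"
  by (intro Pole_rules) (simp_all add: assms)

lemma Pole_pass:
  assumes "env s" "is_term x"
  shows "\<lbrakk>is_term f; is_stack p; f \<star> ev (s(n := x)) t \<^bold>\<cdot> p \<in>\<^sub>M Pole A\<rbrakk>
    \<Longrightarrow> ev s (pass n t) \<star> x \<^bold>\<cdot> f \<^bold>\<cdot> p \<in>\<^sub>M Pole A"
proof (induction t arbitrary: f p)
  case (V m)
  show ?case
  proof (cases "m = n")
    case True
    then show ?thesis unfolding pass.simps if_P[OF True] ev.simps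
      by (intro Pole_rules) (use V assms in simp_all)
  next
    case False
    then show ?thesis unfolding pass.simps if_not_P[OF False] ev.simps
      by (intro Pole_rules) (use V assms in simp_all)
  qed
next
  case (Ap t u)
  have t: "ev s (pass n t) \<star> x \<^bold>\<cdot> g \<^bold>\<cdot> p \<in>\<^sub>M Pole A"
    if "is_term g" "g \<star> ev (s(n := x)) t \<^bold>\<cdot> p \<in>\<^sub>M Pole A" for g
    by (rule Ap.IH(1)[OF that(1) Ap.prems(2) that(2)])
  \<comment> \<open>The continuation B f t[x] is what remains after the first component has been
    delivered: on receiving u[x] it calls f on the literal application of t[x] to u[x].\<close>
  have u: "ev s (pass n u) \<star> x \<^bold>\<cdot> ap (ap (InsB A) f) (ev (s(n := x)) t) \<^bold>\<cdot> p \<in>\<^sub>M Pole A"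
    by (intro Ap.IH(2) Pole_rules) (use Ap.prems assms in \<open>simp_all del: fun_upd_apply\<close>)
  show ?case
    unfolding pass.simps ev.simps
    by (intro Pole_ap[of "InsW A"] Pole_W Pole_chain t Pole_ap)
      (use u Ap.prems assms in \<open>simp_all del: fun_upd_apply\<close>)
qed (use assms in \<open>simp_all add: Pole_const\<close>)

lemma Pole_Lam:
  assumes "env s" "is_term x" "is_stack p" "ev (s(n := x)) t \<star> p \<in>\<^sub>M Pole A"
  shows "ev s (Lam n t) \<star> x \<^bold>\<cdot> p \<in>\<^sub>M Pole A"
  unfolding Lam_def ev.simps
  by (intro Pole_rules Pole_pass) (use assms in simp_all)

section \<open>Deduction rules for realizers\<close>

lemma realizes_is_term: "x \<tturnstile> F \<Longrightarrow> is_term x"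
  by (simp add: realizes_def)

lemma realizes_cong: "falsity F = falsity G \<Longrightarrow> x \<tturnstile> F \<Longrightarrow> x \<tturnstile> G"
  by (simp add: realizes_def)

lemma realizes_Imp:
  assumes "is_term x" "\<And>y p. y \<tturnstile> F \<Longrightarrow> p \<in> falsity G \<Longrightarrow> x \<star> y \<^bold>\<cdot> p \<in>\<^sub>M Pole A"
  shows "x \<tturnstile> F \<^bold>\<rightarrow> G"
  using assms by (auto simp: realizes_def)

lemma realizes_ImpD: "x \<tturnstile> F \<^bold>\<rightarrow> G \<Longrightarrow> y \<tturnstile> F \<Longrightarrow> p \<in> falsity G \<Longrightarrow> x \<star> y \<^bold>\<cdot> p \<in>\<^sub>M Pole A"
  by (auto simp: realizes_def)

lemma realizesD: "x \<tturnstile> F \<Longrightarrow> p \<in> falsity F \<Longrightarrow> x \<star> p \<in>\<^sub>M Pole A"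
  by (simp add: realizes_def)

lemma realizesI: "is_term x \<Longrightarrow> (\<And>p. p \<in> falsity F \<Longrightarrow> x \<star> p \<in>\<^sub>M Pole A) \<Longrightarrow> x \<tturnstile> F"
  by (simp add: realizes_def)

lemma realizes_Lam:
  assumes "env s" "\<And>x. x \<tturnstile> F \<Longrightarrow> is_term x \<Longrightarrow> ev (s(n := x)) t \<tturnstile> G"
  shows "ev s (Lam n t) \<tturnstile> F \<^bold>\<rightarrow> G"
proof (rule realizes_Imp)
  fix x p assume x: "x \<tturnstile> F" and p: "p \<in> falsity G"
  show "ev s (Lam n t) \<star> x \<^bold>\<cdot> p \<in>\<^sub>M Pole A"
    by (rule Pole_Lam[OF assms(1) realizes_is_term[OF x] falsity_is_stack[OF p]
          realizesD[OF assms(2)[OF x realizes_is_term[OF x]] p]])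
qed (simp add: assms)

lemma realizes_ap:
  assumes "x \<tturnstile> F \<^bold>\<rightarrow> G" "y \<tturnstile> F"
  shows "ap x y \<tturnstile> G"
proof (rule realizesI)
  fix p assume p: "p \<in> falsity G"
  show "ap x y \<star> p \<in>\<^sub>M Pole A"
    by (rule Pole_ap[OF assms[THEN realizes_is_term] falsity_is_stack[OF p]
          realizes_ImpD[OF assms p]])
qed (simp add: assms[THEN realizes_is_term])

text \<open>The continuation discards the current stack, whatever \<open>G\<close> is, and restores
  \<open>p\<close>, against which every realizer of \<open>F\<close> succeeds.\<close>

lemma cont_realizes:
  assumes "p \<in> falsity F"
  shows "cont p \<tturnstile> F \<^bold>\<rightarrow> G"
proof (rule realizes_Imp)
  fix x q assume x: "x \<tturnstile> F" and q: "q \<in> falsity G"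
  show "cont p \<star> x \<^bold>\<cdot> q \<in>\<^sub>M Pole A"
    by (rule Pole_cont[OF realizes_is_term[OF x] falsity_is_stack[OF assms] falsity_is_stack[OF q]
          realizesD[OF x assms]])
qed (simp add: falsity_is_stack[OF assms])

lemma realizes_cc:
  assumes "x \<tturnstile> (F \<^bold>\<rightarrow> Bot) \<^bold>\<rightarrow> Bot"
  shows "ap (InsCC A) x \<tturnstile> F"
proof (rule realizesI)
  fix p assume p: "p \<in> falsity F"
  then have q: "is_stack p" by (rule falsity_is_stack)
  have x: "is_term x" using assms by (rule realizes_is_term)
  have "x \<star> cont p \<^bold>\<cdot> p \<in>\<^sub>M Pole A"
    by (rule realizes_ImpD[OF assms cont_realizes[OF p]]) (simp add: q)
  then show "ap (InsCC A) x \<star> p \<in>\<^sub>M Pole A"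
    by (intro Pole_ap Pole_cc) (simp_all add: q x)
qed (simp add: realizes_is_term[OF assms])

lemma realizes_cc_cont: "q \<in> falsity (F \<^bold>\<rightarrow> Bot) \<Longrightarrow> ap (InsCC A) (cont q) \<tturnstile> F"
  by (intro realizes_cc cont_realizes)

lemma realizes_Forall: "(\<And>x. t \<tturnstile> F x) \<Longrightarrow> t \<tturnstile> Forall F"
  by (auto simp: realizes_def)

lemma realizes_ForallD: "t \<tturnstile> Forall F \<Longrightarrow> t \<tturnstile> F x"
  by (auto simp: realizes_def)

lemma realizes_ForallGimel: "is_term t \<Longrightarrow> (\<And>x. x \<in>\<^sub>M X \<Longrightarrow> t \<tturnstile> F x) \<Longrightarrow> t \<tturnstile> ForallGimel X F"
  by (auto simp: realizes_def)

lemma realizes_ForallGimelD: "t \<tturnstile> ForallGimel X F \<Longrightarrow> x \<in>\<^sub>M X \<Longrightarrow> t \<tturnstile> F x"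
  by (auto simp: realizes_def)

lemma realizes_I: "falsity G \<subseteq> falsity F \<Longrightarrow> InsI A \<tturnstile> F \<^bold>\<rightarrow> G"
  by (rule realizes_Imp) (auto simp: realizes_def intro: Pole_I falsity_is_stack)

lemma realizes_K: "InsK A \<tturnstile> F \<^bold>\<rightarrow> G \<^bold>\<rightarrow> F"
  by (rule realizes_Imp) (auto simp: realizes_def intro: Pole_K falsity_is_stack)

lemma realizes_KI: "ap (InsK A) (InsI A) \<tturnstile> F \<^bold>\<rightarrow> G \<^bold>\<rightarrow> G"
  by (intro realizes_ap[OF realizes_K] realizes_I) simp

lemma realizes_Fst: "env s \<Longrightarrow> ev s Fst \<tturnstile> F \<^bold>\<and> G \<^bold>\<rightarrow> F"
  unfolding Fst_def Conj_def
  by (rule realizes_Lam | rule realizes_cc | assumption | rule realizes_ap | simp)+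

lemma realizes_Snd: "env s \<Longrightarrow> ev s Snd \<tturnstile> F \<^bold>\<and> G \<^bold>\<rightarrow> G"
  unfolding Snd_def Conj_def
  by (rule realizes_Lam | rule realizes_cc | assumption | rule realizes_ap | simp)+

lemma realizes_Fst_ap: "env s \<Longrightarrow> c \<tturnstile> F \<^bold>\<and> G \<Longrightarrow> ap (ev s Fst) c \<tturnstile> F"
  by (rule realizes_ap[OF realizes_Fst])

lemma realizes_Snd_ap: "env s \<Longrightarrow> c \<tturnstile> F \<^bold>\<and> G \<Longrightarrow> ap (ev s Snd) c \<tturnstile> G"
  by (rule realizes_ap[OF realizes_Snd])

lemma realizes_Pair: "env s \<Longrightarrow> ev s Pair \<tturnstile> F \<^bold>\<rightarrow> G \<^bold>\<rightarrow> F \<^bold>\<and> G"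
  unfolding Pair_def Conj_def
  by (rule realizes_Lam | rule realizes_cc | assumption | rule realizes_ap | simp)+

lemma definable_family_Conj:
  "definable_family F \<Longrightarrow> definable_family G \<Longrightarrow> definable_family (\<lambda>e. F e \<^bold>\<and> G e)"
  unfolding Conj_def by (intro definable_family_intros)

lemma definable_family_Eps:
  "definable_fun f \<Longrightarrow> definable_fun g \<Longrightarrow> definable_family (\<lambda>e. Eps (f e) (g e))"
  unfolding Eps_def Neg_def by (intro definable_family_intros)

lemma falsity_ForallGimel_cong:
  "(\<And>x. x \<in>\<^sub>M X \<Longrightarrow> falsity (F x) = falsity (G x)) \<Longrightarrow>
    falsity (ForallGimel X F) = falsity (ForallGimel X G)"
  by auto

lemma falsity_Imp_cong:
  "falsity F = falsity F' \<Longrightarrow> falsity G = falsity G' \<Longrightarrow> falsity (F \<^bold>\<rightarrow> G) = falsity (F' \<^bold>\<rightarrow> G')"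
  by simp

lemma falsity_Imp_antimono:
  "falsity F \<subseteq> falsity F' \<Longrightarrow> falsity (F' \<^bold>\<rightarrow> G) \<subseteq> falsity (F \<^bold>\<rightarrow> G)"
  by auto

text \<open>
  A stack refuting two formulas, saved as a continuation, yields a common realizer of both; this is
  why a pigeonhole on stacks suffices and pairs of a term and a stack need not be counted.
\<close>

lemma Pole_Escape:
  assumes s: "env s" and tm: "is_term c" "is_term d"
    and q: "q \<in> falsity (F \<^bold>\<rightarrow> Bot)" "q \<in> falsity (G \<^bold>\<rightarrow> Bot)"
    and f: "f \<tturnstile> F \<^bold>\<rightarrow> G \<^bold>\<rightarrow> H \<^bold>\<rightarrow> K \<^bold>\<rightarrow> Bot" and c: "c \<tturnstile> H" and d: "d \<tturnstile> K"
  shows "ap (ap (ap (ev s Escape) f) c) d \<star> q \<in>\<^sub>M Pole A"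
proof -
  have q': "is_stack q" using q(1) by (rule falsity_is_stack)
  have f': "is_term f" using f by (rule realizes_is_term)
  let ?k = "ap (InsCC A) (cont q)"
  have "ap (ap (ap (ap f ?k) ?k) c) d \<tturnstile> Bot"
    by (rule realizes_ap[OF realizes_ap[OF realizes_ap[OF realizes_ap[OF f
      realizes_cc_cont[OF q(1)]] realizes_cc_cont[OF q(2)]] c] d])
  then have "ap (ap (ap (ap f ?k) ?k) c) d \<star> q \<in>\<^sub>M Pole A"
    using q' by (simp add: realizes_def)
  then have "ev (s(0 := f, 1 := c, 2 := d, 3 := cont q))
      (V 0 \<bullet> (TCC \<bullet> V 3) \<bullet> (TCC \<bullet> V 3) \<bullet> V 1 \<bullet> V 2) \<star> q \<in>\<^sub>M Pole A"
    by simp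
  then have "ev (s(0 := f, 1 := c, 2 := d))
      (TCC \<bullet> Lam 3 (V 0 \<bullet> (TCC \<bullet> V 3) \<bullet> (TCC \<bullet> V 3) \<bullet> V 1 \<bullet> V 2)) \<star> q \<in>\<^sub>M Pole A"
    unfolding ev.simps(2)[of _ TCC] ev.simps(8)
    by (intro Pole_ap Pole_cc Pole_Lam) (use s tm f' q' in simp_all)
  then show ?thesis
    unfolding Escape_def by (intro Pole_ap Pole_Lam) (use s tm f' q' in simp_all)
qed

text \<open>If the conclusion failed, every \<open>w\<close> would have a stack refuting
  \<open>NotEps w G\<close> on which \<open>t\<close> fails. By \<open>collision\<close> such a
  stack serves only one \<open>w\<close>, so sending it to that \<open>w\<close> would map a class
  of stacks onto the power set of \<open>k\<close>.\<close>

lemma realizes_not_mem_of_no_collision: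
  assumes bij: "is_bij h k B" and B: "\<And>p. is_stack p \<Longrightarrow> p \<in>\<^sub>M B" and t: "is_term t"
    and collision: "\<And>u v q. \<lbrakk>u \<in>\<^sub>M powerset k; v \<in>\<^sub>M powerset k; u \<noteq> v;
      q \<in> falsity (NotEps u G \<^bold>\<rightarrow> Bot); q \<in> falsity (NotEps v G \<^bold>\<rightarrow> Bot)\<rbrakk> \<Longrightarrow> t \<star> q \<in>\<^sub>M Pole A"
  shows "\<exists>w. w \<in>\<^sub>M powerset k \<and> (t \<tturnstile> NotEps w G \<^bold>\<rightarrow> Bot)"
proof -
  \<comment> \<open>Failure of \<open>t\<close> on \<open>q\<close> is spelled out through the graph
    \<open>Star A\<close>, so that \<open>Q\<close> is visibly definable.\<close>
  define Q where "Q = (\<lambda>w q. w \<in>\<^sub>M powerset k \<and> q \<in> falsity (NotEps w G \<^bold>\<rightarrow> Bot) \<and>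
    \<not> (\<exists>z. z \<in>\<^sub>M Pole A \<and> pair (pair t q) z \<in>\<^sub>M Star A))"
  have Q: "Q w q \<longleftrightarrow> w \<in>\<^sub>M powerset k \<and> q \<in> falsity (NotEps w G \<^bold>\<rightarrow> Bot) \<and> \<not> t \<star> q \<in>\<^sub>M Pole A" for w q
    using star_mem_Pole_iff[OF t falsity_is_stack] unfolding Q_def by blast
  have fam: "definable_family (\<lambda>e. NotEps (e 0) G \<^bold>\<rightarrow> Bot)"
    by (intro definable_family_intros)
  have "definable (\<lambda>e. Q (e 0) (e 1))"
    using definable_family_rename[OF fam, of 1 id] unfolding Q_def
    by (intro definable_intros definable_fun_pair) simp
  then have "\<exists>w. w \<in>\<^sub>M powerset k \<and> (\<forall>q. \<not> Q w q)"
    by (rule no_surjection_to_powerset[OF bij]) (use Q collision B falsity_is_stack in blast)+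
  then show ?thesis using t Q unfolding realizes_def by blast
qed

end

section \<open>Induction along the well-ordering\<close>

locale ordered_gimel = zf_realizability mem A
  for mem :: "'m \<Rightarrow> 'm \<Rightarrow> bool"  (infix "\<in>\<^sub>M" 50) and A :: "'m realizability_structure" +
  fixes U r :: 'm
begin

abbreviation lt :: "'m \<Rightarrow> 'm \<Rightarrow> 'm zfe" where
  "lt u v \<equiv> Eps (pair u v) r"

definition transitive_order :: "'m zfe" where
  "transitive_order = ForallGimel U (\<lambda>u. ForallGimel U (\<lambda>v. ForallGimel U (\<lambda>w.
    lt u v \<^bold>\<rightarrow> lt v w \<^bold>\<rightarrow> lt u w)))"

lemma transitive_orderD:
  assumes "t \<tturnstile> transitive_order" "u \<in>\<^sub>M U" "v \<in>\<^sub>M U" "w \<in>\<^sub>M U"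
  shows "t \<tturnstile> lt u v \<^bold>\<rightarrow> lt v w \<^bold>\<rightarrow> lt u w"
  by (rule realizes_ForallGimelD[OF realizes_ForallGimelD[OF realizes_ForallGimelD[OF
          assms(1)[unfolded transitive_order_def] assms(2)] assms(3)] assms(4)])

definition total_order :: "'m zfe" where
  "total_order = ForallGimel U (\<lambda>u. ForallGimel U (\<lambda>v.
    Neq u v \<^bold>\<rightarrow> NotEps (pair u v) r \<^bold>\<rightarrow> lt v u))"

lemma total_orderD:
  assumes "t \<tturnstile> total_order" "u \<in>\<^sub>M U" "v \<in>\<^sub>M U"
  shows "t \<tturnstile> Neq u v \<^bold>\<rightarrow> NotEps (pair u v) r \<^bold>\<rightarrow> lt v u"
  by (rule realizes_ForallGimelD[OF realizes_ForallGimelD[OF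
          assms(1)[unfolded total_order_def] assms(2)] assms(3)])

definition least_elements :: "'m zfe" where
  "least_elements =
    Forall (\<lambda>e. Forall (\<lambda>x. Eps x e \<^bold>\<rightarrow> Eps x (gimel U)) \<^bold>\<rightarrow> Exists (\<lambda>x. Eps x e) \<^bold>\<rightarrow>
      Exists (\<lambda>x. Eps x e \<^bold>\<and> Forall (\<lambda>y. Eps y e \<^bold>\<rightarrow> NotEps (pair y x) r)))"

definition progressive :: "('m \<Rightarrow> 'm zfe) \<Rightarrow> 'm zfe" where
  "progressive N = ForallGimel U (\<lambda>x. ForallGimel U (\<lambda>y. lt y x \<^bold>\<rightarrow> N y) \<^bold>\<rightarrow> N x)"

lemma falsity_NotEps_gimel:
  "falsity (NotEps x (gimel U)) = (if x \<in>\<^sub>M U then {p. is_stack p} else {})"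
  by (auto simp: gimel_def)

text \<open>Minimal counterexample: \<open>e\<close> is the set of elements at which
  \<open>N\<close> fails, with \<open>NotEps u e\<close> standing for \<open>N u\<close>. The two
  have equal falsity values on \<open>U\<close>, so \<open>Ind\<close> is a single term that does
  not depend on \<open>N\<close>.\<close>

lemma realizes_Ind:
  assumes s: "env s" and N: "definable_family (\<lambda>e. N (e 0))"
  shows "ev s Ind \<tturnstile> least_elements \<^bold>\<rightarrow> progressive N \<^bold>\<rightarrow> ForallGimel U N"
proof -
  obtain e where e: "\<And>u. falsity (NotEps u e) = (if u \<in>\<^sub>M U then falsity (N u) else {})"
    using comprehension[OF N, of U] by blast
  have "ev s Ind \<tturnstile> least_elements \<^bold>\<rightarrow> progressive (\<lambda>u. NotEps u e) \<^bold>\<rightarrow>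
      ForallGimel U (\<lambda>u. NotEps u e)"
    unfolding Ind_def
  proof (intro realizes_Lam realizes_ForallGimel)
    fix L H x0
    assume L: "L \<tturnstile> least_elements" and H: "H \<tturnstile> progressive (\<lambda>u. NotEps u e)"
      and tm: "is_term L" "is_term H" and x0: "x0 \<in>\<^sub>M U"
    have H': "H \<tturnstile> ForallGimel U (\<lambda>y. (NotEps (pair y x) r \<^bold>\<rightarrow> Bot) \<^bold>\<rightarrow> NotEps y e) \<^bold>\<rightarrow> NotEps x e"
      if "x \<in>\<^sub>M U" for x
      using realizes_ForallGimelD[OF H[unfolded progressive_def Eps_def Neg_def] that] .
    \<comment> \<open>Within \<open>U\<close> the falsity value of \<open>NotEps x (gimel U)\<close>
      is all of \<Pi>, and outside \<open>U\<close> both values are empty. The inclusion of falsity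
      values lets the identity realize that \<open>e\<close> is contained in \<gimel>U.\<close>
    have I: "InsI A \<tturnstile> Forall (\<lambda>x. (NotEps x e \<^bold>\<rightarrow> Bot) \<^bold>\<rightarrow> NotEps x (gimel U) \<^bold>\<rightarrow> Bot)"
      by (intro realizes_Forall realizes_I falsity_Imp_antimono)
        (auto simp only: e falsity_NotEps_gimel split: if_splits intro: falsity_is_stack)
    note L' = realizes_ForallD[OF L[unfolded least_elements_def Exists_def Eps_def Neg_def Conj_def], of e]
    have "ev (s(0 := L, 1 := H)) (Lam 2 (V 0 \<bullet> TI \<bullet> Lam 3 (V 3 \<bullet> V 2) \<bullet> Lam 4 (V 4 \<bullet>
        Lam 5 (Lam 6 (V 5 \<bullet> (V 1 \<bullet> Lam 7 (TCC \<bullet> Lam 8 (V 7 \<bullet> (V 6 \<bullet> V 8)))))))))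
      \<tturnstile> (NotEps x0 e \<^bold>\<rightarrow> Bot) \<^bold>\<rightarrow> Bot"
    proof (rule realizes_Lam)
      fix k assume k: "k \<tturnstile> NotEps x0 e \<^bold>\<rightarrow> Bot" "is_term k"
      let ?s = "s(0 := L, 1 := H, 2 := k)"
      have step: "ev ?s (Lam 4 (V 4 \<bullet> Lam 5 (Lam 6 (V 5 \<bullet>
          (V 1 \<bullet> Lam 7 (TCC \<bullet> Lam 8 (V 7 \<bullet> (V 6 \<bullet> V 8)))))))) \<tturnstile>
        (((NotEps x e \<^bold>\<rightarrow> Bot) \<^bold>\<rightarrow> Forall (\<lambda>y. (NotEps y e \<^bold>\<rightarrow> Bot) \<^bold>\<rightarrow> NotEps (pair y x) r)
          \<^bold>\<rightarrow> Bot) \<^bold>\<rightarrow> Bot) \<^bold>\<rightarrow> Bot" for x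
      proof (rule realizes_Lam)
        fix c assume c: "c \<tturnstile> ((NotEps x e \<^bold>\<rightarrow> Bot) \<^bold>\<rightarrow>
          Forall (\<lambda>y. (NotEps y e \<^bold>\<rightarrow> Bot) \<^bold>\<rightarrow> NotEps (pair y x) r) \<^bold>\<rightarrow> Bot) \<^bold>\<rightarrow> Bot" "is_term c"
        let ?s = "s(0 := L, 1 := H, 2 := k, 4 := c)"
        have "ev ?s (Lam 5 (Lam 6 (V 5 \<bullet> (V 1 \<bullet> Lam 7 (TCC \<bullet> Lam 8 (V 7 \<bullet> (V 6 \<bullet> V 8))))))) \<tturnstile>
          (NotEps x e \<^bold>\<rightarrow> Bot) \<^bold>\<rightarrow>
          Forall (\<lambda>y. (NotEps y e \<^bold>\<rightarrow> Bot) \<^bold>\<rightarrow> NotEps (pair y x) r) \<^bold>\<rightarrow> Bot"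
        proof (intro realizes_Lam)
          fix p m assume p: "p \<tturnstile> NotEps x e \<^bold>\<rightarrow> Bot" "is_term p"
            and m: "m \<tturnstile> Forall (\<lambda>y. (NotEps y e \<^bold>\<rightarrow> Bot) \<^bold>\<rightarrow> NotEps (pair y x) r)" "is_term m"
          note m' = realizes_ForallD[OF m(1)]
          let ?s = "s(0 := L, 1 := H, 2 := k, 4 := c, 5 := p, 6 := m)"
          have "ev ?s (Lam 7 (TCC \<bullet> Lam 8 (V 7 \<bullet> (V 6 \<bullet> V 8)))) \<tturnstile>
              ForallGimel U (\<lambda>y. (NotEps (pair y x) r \<^bold>\<rightarrow> Bot) \<^bold>\<rightarrow> NotEps y e)"
          proof (intro realizes_ForallGimel realizes_Lam)
            fix y l assume l: "l \<tturnstile> NotEps (pair y x) r \<^bold>\<rightarrow> Bot" "is_term l"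
            \<comment> \<open>Minimality \<open>m\<close> says that no element of \<open>e\<close>
              precedes \<open>x\<close>. So \<open>y\<close> preceding \<open>x\<close> is not in
              \<open>e\<close>, which is first obtained doubly negated and then freed by
              \<open>TCC\<close>.\<close>
            have "ev (?s(7 := l)) (Lam 8 (V 7 \<bullet> (V 6 \<bullet> V 8))) \<tturnstile> (NotEps y e \<^bold>\<rightarrow> Bot) \<^bold>\<rightarrow> Bot"
            proof (rule realizes_Lam)
              fix k' assume "k' \<tturnstile> NotEps y e \<^bold>\<rightarrow> Bot"
              from realizes_ap[OF l(1) realizes_ap[OF m' this]]
              show "ev (?s(7 := l, 8 := k')) (V 7 \<bullet> (V 6 \<bullet> V 8)) \<tturnstile> Bot" by simp
            qed (use s tm k(2) c(2) p(2) m(2) l(2) in simp)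
            from realizes_cc[OF this]
            show "ev (?s(7 := l)) (TCC \<bullet> Lam 8 (V 7 \<bullet> (V 6 \<bullet> V 8))) \<tturnstile> NotEps y e" by simp
          qed (use s tm k(2) c(2) p(2) m(2) in simp_all)
          then have "ev ?s (V 1 \<bullet> Lam 7 (TCC \<bullet> Lam 8 (V 7 \<bullet> (V 6 \<bullet> V 8)))) \<tturnstile> NotEps x e"
          proof (cases "x \<in>\<^sub>M U")
            \<comment> \<open>Outside \<open>U\<close> the falsity value is empty and any term is a
              realizer.\<close>
            case False
            then show ?thesis
              using s tm k(2) c(2) p(2) m(2) by (intro realizesI) (simp_all add: e del: falsity.simps(3))
          qed (simp add: realizes_ap[OF H'])
          then show "ev ?s (V 5 \<bullet> (V 1 \<bullet> Lam 7 (TCC \<bullet> Lam 8 (V 7 \<bullet> (V 6 \<bullet> V 8))))) \<tturnstile> Bot"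
            using realizes_ap[OF p(1)] by simp
        qed (use s tm k c in simp_all)
        then show "ev ?s (V 4 \<bullet> Lam 5 (Lam 6 (V 5 \<bullet>
            (V 1 \<bullet> Lam 7 (TCC \<bullet> Lam 8 (V 7 \<bullet> (V 6 \<bullet> V 8))))))) \<tturnstile> Bot"
          using realizes_ap[OF c(1)] by simp
      qed (use s tm k in simp_all)
      have "ev ?s (Lam 3 (V 3 \<bullet> V 2)) \<tturnstile> Forall (\<lambda>x. (NotEps x e \<^bold>\<rightarrow> Bot) \<^bold>\<rightarrow> Bot) \<^bold>\<rightarrow> Bot"
      proof (rule realizes_Lam)
        fix f assume "f \<tturnstile> Forall (\<lambda>x. (NotEps x e \<^bold>\<rightarrow> Bot) \<^bold>\<rightarrow> Bot)"
        from realizes_ap[OF realizes_ForallD[OF this] k(1)]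
        show "ev (?s(3 := f)) (V 3 \<bullet> V 2) \<tturnstile> Bot" by simp
      qed (use s tm k in simp)
      from realizes_ap[OF realizes_ap[OF realizes_ap[OF L' I] this] realizes_Forall[OF step]]
      show "ev ?s (V 0 \<bullet> TI \<bullet> Lam 3 (V 3 \<bullet> V 2) \<bullet> Lam 4 (V 4 \<bullet> Lam 5 (Lam 6 (V 5 \<bullet>
          (V 1 \<bullet> Lam 7 (TCC \<bullet> Lam 8 (V 7 \<bullet> (V 6 \<bullet> V 8)))))))) \<tturnstile> Bot"
        by simp
    qed (use s tm in simp)
    from realizes_cc[OF this]
    show "ev (s(0 := L, 1 := H)) (TCC \<bullet> Lam 2 (V 0 \<bullet> TI \<bullet> Lam 3 (V 3 \<bullet> V 2) \<bullet> Lam 4 (V 4 \<bullet>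
        Lam 5 (Lam 6 (V 5 \<bullet> (V 1 \<bullet> Lam 7 (TCC \<bullet> Lam 8 (V 7 \<bullet> (V 6 \<bullet> V 8)))))))))
      \<tturnstile> NotEps x0 e"
      by simp
  qed (use s in simp_all)
  moreover have "falsity (progressive (\<lambda>u. NotEps u e)) = falsity (progressive N)"
    unfolding progressive_def
    by (intro falsity_ForallGimel_cong falsity_Imp_cong refl) (simp_all only: e if_True)
  moreover have "falsity (ForallGimel U (\<lambda>u. NotEps u e)) = falsity (ForallGimel U N)"
    by (intro falsity_ForallGimel_cong) (simp only: e if_True)
  ultimately show ?thesis
    by (elim realizes_cong[rotated]) (intro falsity_Imp_cong refl)
qed

text \<open>The guards that \<open>x\<close>, \<open>y\<close>, \<open>z\<close> lie in \<gimel>U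
  are discharged by the identity, giving the versions relativized to \<open>U\<close>. Stating the
  result as an elimination into \<open>Bot\<close> fits the encoding of conjunction: each
  conjunction is opened by applying it.\<close>

lemma realizes_Well_order:
  assumes s: "env s"
  shows "ev s Well_order \<tturnstile> well_orders r (gimel U) \<^bold>\<rightarrow>
    (transitive_order \<^bold>\<rightarrow> total_order \<^bold>\<rightarrow> least_elements \<^bold>\<rightarrow> Bot) \<^bold>\<rightarrow> Bot"
proof -
  have I: "InsI A \<tturnstile> Eps u (gimel U)" if "u \<in>\<^sub>M U" for u
    unfolding Eps_def Neg_def using that
    by (intro realizes_I) (simp only: falsity_NotEps_gimel if_True falsity.simps(2) subset_refl)
  let ?G = "gimel U"
  let ?tr = "Forall (\<lambda>x. Forall (\<lambda>y. Forall (\<lambda>z. Eps x ?G \<^bold>\<rightarrow> Eps y ?G \<^bold>\<rightarrow> Eps z ?G \<^bold>\<rightarrow>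
       Eps (pair x y) r \<^bold>\<rightarrow> Eps (pair y z) r \<^bold>\<rightarrow> Eps (pair x z) r)))"
  let ?to = "Forall (\<lambda>x. Forall (\<lambda>y. Eps x ?G \<^bold>\<rightarrow> Eps y ?G \<^bold>\<rightarrow>
       Neq x y \<^bold>\<rightarrow> NotEps (pair x y) r \<^bold>\<rightarrow> Eps (pair y x) r))"
  have tr: "ap (ap (ap t (InsI A)) (InsI A)) (InsI A) \<tturnstile> transitive_order" if t: "t \<tturnstile> ?tr" for t
    unfolding transitive_order_def
  proof (intro realizes_ForallGimel)
    fix u v w assume u: "u \<in>\<^sub>M U" and v: "v \<in>\<^sub>M U" and w: "w \<in>\<^sub>M U"
    show "ap (ap (ap t (InsI A)) (InsI A)) (InsI A) \<tturnstile> lt u v \<^bold>\<rightarrow> lt v w \<^bold>\<rightarrow> lt u w"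
      by (rule realizes_ap[OF realizes_ap[OF realizes_ap[OF
        realizes_ForallD[OF realizes_ForallD[OF realizes_ForallD[OF t]]] I[OF u]] I[OF v]] I[OF w]])
  qed (use t realizes_is_term in simp_all)
  have to: "ap (ap t (InsI A)) (InsI A) \<tturnstile> total_order" if t: "t \<tturnstile> ?to" for t
    unfolding total_order_def
  proof (intro realizes_ForallGimel)
    fix u v assume u: "u \<in>\<^sub>M U" and v: "v \<in>\<^sub>M U"
    show "ap (ap t (InsI A)) (InsI A) \<tturnstile> Neq u v \<^bold>\<rightarrow> NotEps (pair u v) r \<^bold>\<rightarrow> lt v u"
      by (rule realizes_ap[OF realizes_ap[OF
        realizes_ForallD[OF realizes_ForallD[OF t]] I[OF u]] I[OF v]])
  qed (use t realizes_is_term in simp_all)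
  show ?thesis
    unfolding Well_order_def
  proof (intro realizes_Lam)
    fix wo k
    assume wo: "wo \<tturnstile> well_orders r (gimel U)"
      and k: "k \<tturnstile> transitive_order \<^bold>\<rightarrow> total_order \<^bold>\<rightarrow> least_elements \<^bold>\<rightarrow> Bot"
      and tm: "is_term wo" "is_term k"
    let ?s = "s(0 := wo, 1 := k)"
    let ?u = "Lam 6 (Lam 7 (V 1 \<bullet> (V 4 \<bullet> TI \<bullet> TI \<bullet> TI) \<bullet> (V 6 \<bullet> TI \<bullet> TI) \<bullet> V 7))"
    let ?t = "Lam 4 (Lam 5 (V 5 \<bullet> ?u))"
    have u: "ev (?s(2 := x, 3 := y, 4 := p, 5 := q)) ?u \<tturnstile> ?to \<^bold>\<rightarrow> least_elements \<^bold>\<rightarrow> Bot"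
      if "is_term x" "is_term y" "is_term p" "is_term q" and p: "p \<tturnstile> ?tr" for x y p q
    proof (intro realizes_Lam)
      fix m n assume m: "m \<tturnstile> ?to" and n: "n \<tturnstile> least_elements"
      from realizes_ap[OF realizes_ap[OF realizes_ap[OF k tr[OF p]] to[OF m]] n]
      show "ev (?s(2 := x, 3 := y, 4 := p, 5 := q, 6 := m, 7 := n))
        (V 1 \<bullet> (V 4 \<bullet> TI \<bullet> TI \<bullet> TI) \<bullet> (V 6 \<bullet> TI \<bullet> TI) \<bullet> V 7) \<tturnstile> Bot" by simp
    qed (use s tm that in simp_all)
    have t: "ev (?s(2 := x, 3 := y)) ?t \<tturnstile> ?tr \<^bold>\<rightarrow> ?to \<^bold>\<and> least_elements \<^bold>\<rightarrow> Bot"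
      if xy: "is_term x" "is_term y" for x y
    proof (intro realizes_Lam)
      fix p q assume p: "p \<tturnstile> ?tr" "is_term p" and q: "q \<tturnstile> ?to \<^bold>\<and> least_elements" "is_term q"
      from realizes_ap[OF q(1)[unfolded Conj_def] u[OF xy p(2) q(2) p(1)]]
      show "ev (?s(2 := x, 3 := y, 4 := p, 5 := q)) (V 5 \<bullet> ?u) \<tturnstile> Bot" by simp
    qed (use s tm that in simp_all)
    have "ev ?s (Lam 2 (Lam 3 (V 3 \<bullet> ?t))) \<tturnstile>
        F \<^bold>\<rightarrow> ?tr \<^bold>\<and> ?to \<^bold>\<and> least_elements \<^bold>\<rightarrow> Bot" for F
    proof (intro realizes_Lam)
      fix x y assume x: "is_term x" and y: "y \<tturnstile> ?tr \<^bold>\<and> ?to \<^bold>\<and> least_elements" "is_term y"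
      from realizes_ap[OF y(1)[unfolded Conj_def[of ?tr]] t[OF x y(2)]]
      show "ev (?s(2 := x, 3 := y)) (V 3 \<bullet> ?t) \<tturnstile> Bot" by simp
    qed (use s tm in simp_all)
    note w = realizes_ap[OF wo[unfolded well_orders_def least_elements_def[symmetric]
        Conj_def[of "Forall (\<lambda>x. Eps x ?G \<^bold>\<rightarrow> NotEps (pair x x) r)"]] this]
    show "ev ?s (V 0 \<bullet> Lam 2 (Lam 3 (V 3 \<bullet> ?t))) \<tturnstile> Bot"
      using w by simp
  qed (use s in simp_all)
qed

end

section \<open>The greedy matching\<close>

locale greedy = ordered_gimel mem A U r
  for mem :: "'m \<Rightarrow> 'm \<Rightarrow> bool"  (infix "\<in>\<^sub>M" 50) and A :: "'m realizability_structure"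
    and U r :: 'm +
  fixes a b :: "'m \<Rightarrow> 'm \<Rightarrow> 'm zfe"
  assumes definable_a: "definable_family (\<lambda>e. a (e j) (e k))"
    and definable_b: "definable_family (\<lambda>e. b (e j) (e k))"
    and a_sym: "falsity (a u v) = falsity (a v u)"
    and b_sym: "falsity (b u v) = falsity (b v u)"
begin

text \<open>A selection is coded by its complement: \<open>v\<close> counts as selected by
  \<open>g\<close> when \<open>NotEps v g\<close> holds. \<open>NotEps\<close> is the primitive
  formula whose falsity value \<open>comprehension\<close> prescribes exactly, whereas
  \<open>Eps\<close> would add a double negation. The formula says that \<open>u\<close> shares no
  coordinate with a selected predecessor.\<close>

definition avoids :: "'m \<Rightarrow> 'm \<Rightarrow> 'm zfe" where
  "avoids g u = ForallGimel U (\<lambda>v. lt v u \<^bold>\<rightarrow> NotEps v g \<^bold>\<rightarrow> a v u \<^bold>\<and> b v u)"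

definition sound :: "'m \<Rightarrow> 'm \<Rightarrow> 'm zfe" where
  "sound g u = ForallGimel U (\<lambda>w. lt w u \<^bold>\<rightarrow> NotEps w g \<^bold>\<rightarrow> avoids g w)"

definition complete :: "'m \<Rightarrow> 'm \<Rightarrow> 'm zfe" where
  "complete g u = ForallGimel U (\<lambda>w. lt w u \<^bold>\<rightarrow> avoids g w \<^bold>\<rightarrow> NotEps w g)"

text \<open>The guard \<open>lt w u\<close> belongs to the formula because the induction ranges over
  all of \<open>U\<close>, while approximations are constrained only below \<open>u\<close>.\<close>

definition agree :: "'m \<Rightarrow> 'm \<Rightarrow> 'm \<Rightarrow> 'm \<Rightarrow> 'm zfe" where
  "agree g g' u w =
    (lt w u \<^bold>\<rightarrow> (NotEps w g \<^bold>\<rightarrow> NotEps w g') \<^bold>\<and> (NotEps w g' \<^bold>\<rightarrow> NotEps w g))"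

definition matched :: "'m \<Rightarrow> 'm zfe" where
  "matched u = Forall (\<lambda>g. sound g u \<^bold>\<rightarrow> complete g u \<^bold>\<rightarrow> avoids g u)"

lemma definable_agree: "definable_family (\<lambda>e. agree g g' u (e 0))"
  unfolding agree_def
  by (intro definable_family_intros definable_family_Conj definable_family_Eps)

lemma definable_matched: "definable_family (\<lambda>e. matched (e 0))"
  unfolding matched_def sound_def complete_def avoids_def
  by (intro definable_family_intros definable_family_Conj definable_family_Eps definable_a definable_b)

text \<open>Avoiding is antitone in the selection: with fewer elements selected below
  \<open>w\<close>, it is easier to avoid them.\<close>

lemma realizes_Transfer:
  assumes s: "env s"
  shows "ev s Transfer \<tturnstile> ForallGimel U (\<lambda>v. lt v w \<^bold>\<rightarrow> NotEps v g' \<^bold>\<rightarrow> NotEps v g) \<^bold>\<rightarrow>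
    avoids g w \<^bold>\<rightarrow> avoids g' w"
  unfolding Transfer_def avoids_def
proof (intro realizes_Lam realizes_ForallGimel)
  fix h x v l p
  assume h: "h \<tturnstile> ForallGimel U (\<lambda>v. lt v w \<^bold>\<rightarrow> NotEps v g' \<^bold>\<rightarrow> NotEps v g)"
    and x: "x \<tturnstile> ForallGimel U (\<lambda>v. lt v w \<^bold>\<rightarrow> NotEps v g \<^bold>\<rightarrow> a v w \<^bold>\<and> b v w)"
    and v: "v \<in>\<^sub>M U" and l: "l \<tturnstile> lt v w" and p: "p \<tturnstile> NotEps v g'"
  from realizes_ap[OF realizes_ap[OF realizes_ForallGimelD[OF x v] l]
      realizes_ap[OF realizes_ap[OF realizes_ForallGimelD[OF h v] l] p]]
  show "ev (s(0 := h, 1 := x, 2 := l, 3 := p)) (V 1 \<bullet> V 2 \<bullet> (V 0 \<bullet> V 2 \<bullet> V 3)) \<tturnstile> a v w \<^bold>\<and> b v w"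
    by simp
qed (use s in simp_all)

text \<open>The direction of the inclusion flips at each step. If below \<open>w\<close> everything
  selected by \<open>g'\<close> is selected by \<open>g\<close>, then what \<open>g\<close> selects
  at \<open>w\<close> avoids \<open>g\<close>, hence avoids \<open>g'\<close>, hence is selected by
  \<open>g'\<close>. Transitivity brings the predecessors of \<open>w\<close> below
  \<open>u\<close>, where the approximations are controlled.\<close>

lemma realizes_Half:
  assumes s: "env s" and u: "u \<in>\<^sub>M U" and w: "w \<in>\<^sub>M U"
  shows "ev s Half \<tturnstile> transitive_order \<^bold>\<rightarrow>
    ForallGimel U (\<lambda>v. lt v w \<^bold>\<rightarrow> lt v u \<^bold>\<rightarrow> NotEps v g' \<^bold>\<rightarrow> NotEps v g) \<^bold>\<rightarrow>
    lt w u \<^bold>\<rightarrow> sound g u \<^bold>\<rightarrow> complete g' u \<^bold>\<rightarrow> NotEps w g \<^bold>\<rightarrow> NotEps w g'"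
  unfolding Half_def
proof (intro realizes_Lam)
  fix T h l d c p
  assume T: "T \<tturnstile> transitive_order"
    and h: "h \<tturnstile> ForallGimel U (\<lambda>v. lt v w \<^bold>\<rightarrow> lt v u \<^bold>\<rightarrow> NotEps v g' \<^bold>\<rightarrow> NotEps v g)"
    and l: "l \<tturnstile> lt w u" and d: "d \<tturnstile> sound g u" and c: "c \<tturnstile> complete g' u"
    and p: "p \<tturnstile> NotEps w g"
    and tm: "is_term T" "is_term h" "is_term l" "is_term d" "is_term c" "is_term p"
  let ?s = "s(0 := T, 1 := h, 2 := l, 3 := d, 4 := c, 5 := p)"
  have e: "env ?s" using s tm by simp
  have x: "ev ?s (Lam 6 (V 1 \<bullet> V 6 \<bullet> (V 0 \<bullet> V 6 \<bullet> V 2))) \<tturnstile>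
      ForallGimel U (\<lambda>v. lt v w \<^bold>\<rightarrow> NotEps v g' \<^bold>\<rightarrow> NotEps v g)"
  proof (intro realizes_ForallGimel realizes_Lam e)
    fix v m assume v: "v \<in>\<^sub>M U" and m: "m \<tturnstile> lt v w"
    have t: "T \<tturnstile> lt v w \<^bold>\<rightarrow> lt w u \<^bold>\<rightarrow> lt v u"
      by (rule transitive_orderD[OF T v w u])
    from realizes_ap[OF realizes_ap[OF realizes_ForallGimelD[OF h v] m]
        realizes_ap[OF realizes_ap[OF t m] l]]
    show "ev (?s(6 := m)) (V 1 \<bullet> V 6 \<bullet> (V 0 \<bullet> V 6 \<bullet> V 2)) \<tturnstile> NotEps v g' \<^bold>\<rightarrow> NotEps v g"
      by simp
  qed (use e in simp)
  note y = realizes_ap[OF realizes_ap[OF realizes_ForallGimelD[OF d[unfolded sound_def] w] l] p]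
  from realizes_ap[OF realizes_ap[OF realizes_ForallGimelD[OF c[unfolded complete_def] w] l]
      realizes_ap[OF realizes_ap[OF realizes_Transfer[OF e] x] y]]
  show "ev ?s (V 4 \<bullet> V 2 \<bullet> (Transfer \<bullet> Lam 6 (V 1 \<bullet> V 6 \<bullet> (V 0 \<bullet> V 6 \<bullet> V 2)) \<bullet> (V 3 \<bullet> V 2 \<bullet> V 5)))
      \<tturnstile> NotEps w g'"
    by simp
qed (use s in simp_all)

text \<open>Because of this flip both inclusions must be carried through the induction together;
  each half at \<open>w\<close> consumes the opposite half below \<open>w\<close>.\<close>

lemma realizes_Agree_step:
  assumes s: "env s" and u: "u \<in>\<^sub>M U"
  shows "ev s Agree_step \<tturnstile> transitive_order \<^bold>\<rightarrow> sound g u \<^bold>\<rightarrow> complete g u \<^bold>\<rightarrow>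
    sound g' u \<^bold>\<rightarrow> complete g' u \<^bold>\<rightarrow> progressive (agree g g' u)"
  unfolding Agree_step_def progressive_def agree_def
proof (intro realizes_Lam realizes_ForallGimel)
  fix T d c d' c' w h l
  assume T: "T \<tturnstile> transitive_order" and d: "d \<tturnstile> sound g u" and c: "c \<tturnstile> complete g u"
    and d': "d' \<tturnstile> sound g' u" and c': "c' \<tturnstile> complete g' u" and w: "w \<in>\<^sub>M U"
    and h: "h \<tturnstile> ForallGimel U (\<lambda>y. lt y w \<^bold>\<rightarrow> lt y u \<^bold>\<rightarrow>
      (NotEps y g \<^bold>\<rightarrow> NotEps y g') \<^bold>\<and> (NotEps y g' \<^bold>\<rightarrow> NotEps y g))"
    and l: "l \<tturnstile> lt w u"
    and tm: "is_term T" "is_term d" "is_term c" "is_term d'" "is_term c'" "is_term h" "is_term l"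
  let ?s = "s(0 := T, 1 := d, 2 := c, 3 := d', 4 := c', 5 := h, 6 := l)"
  have e: "env ?s" using s tm by simp
  have h1: "ev ?s (Lam 7 (Lam 8 (Snd \<bullet> (V 5 \<bullet> V 7 \<bullet> V 8)))) \<tturnstile>
      ForallGimel U (\<lambda>v. lt v w \<^bold>\<rightarrow> lt v u \<^bold>\<rightarrow> NotEps v g' \<^bold>\<rightarrow> NotEps v g)"
  proof (intro realizes_ForallGimel realizes_Lam)
    fix v m n assume v: "v \<in>\<^sub>M U" and m: "m \<tturnstile> lt v w" "is_term m" and n: "n \<tturnstile> lt v u" "is_term n"
    have "env (?s(7 := m, 8 := n))" using s tm m n by simp
    from realizes_Snd_ap[OF this realizes_ap[OF realizes_ap[OF realizes_ForallGimelD[OF h v] m(1)] n(1)]]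
    show "ev (?s(7 := m, 8 := n)) (Snd \<bullet> (V 5 \<bullet> V 7 \<bullet> V 8)) \<tturnstile> NotEps v g' \<^bold>\<rightarrow> NotEps v g" by simp
  qed (use e in simp_all)
  have h2: "ev ?s (Lam 7 (Lam 8 (Fst \<bullet> (V 5 \<bullet> V 7 \<bullet> V 8)))) \<tturnstile>
      ForallGimel U (\<lambda>v. lt v w \<^bold>\<rightarrow> lt v u \<^bold>\<rightarrow> NotEps v g \<^bold>\<rightarrow> NotEps v g')"
  proof (intro realizes_ForallGimel realizes_Lam)
    fix v m n assume v: "v \<in>\<^sub>M U" and m: "m \<tturnstile> lt v w" "is_term m" and n: "n \<tturnstile> lt v u" "is_term n"
    have "env (?s(7 := m, 8 := n))" using s tm m n by simp
    from realizes_Fst_ap[OF this realizes_ap[OF realizes_ap[OF realizes_ForallGimelD[OF h v] m(1)] n(1)]]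
    show "ev (?s(7 := m, 8 := n)) (Fst \<bullet> (V 5 \<bullet> V 7 \<bullet> V 8)) \<tturnstile> NotEps v g \<^bold>\<rightarrow> NotEps v g'" by simp
  qed (use e in simp_all)
  note half = realizes_ap[OF realizes_ap[OF realizes_ap[OF realizes_ap[OF realizes_ap[OF
    realizes_Half[OF e u w] T]]]]]
  from realizes_ap[OF realizes_ap[OF realizes_Pair[OF e] half[OF h1 l d c']] half[OF h2 l d' c]]
  show "ev ?s (Pair \<bullet>
      (Half \<bullet> V 0 \<bullet> Lam 7 (Lam 8 (Snd \<bullet> (V 5 \<bullet> V 7 \<bullet> V 8))) \<bullet> V 6 \<bullet> V 1 \<bullet> V 4) \<bullet>
      (Half \<bullet> V 0 \<bullet> Lam 7 (Lam 8 (Fst \<bullet> (V 5 \<bullet> V 7 \<bullet> V 8))) \<bullet> V 6 \<bullet> V 3 \<bullet> V 2)) \<tturnstile>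
    (NotEps w g \<^bold>\<rightarrow> NotEps w g') \<^bold>\<and> (NotEps w g' \<^bold>\<rightarrow> NotEps w g)"
    by simp
qed (use s in simp_all)

lemma realizes_Agree:
  assumes s: "env s" and u: "u \<in>\<^sub>M U"
  shows "ev s Agree \<tturnstile> transitive_order \<^bold>\<rightarrow> least_elements \<^bold>\<rightarrow> sound g u \<^bold>\<rightarrow> complete g u \<^bold>\<rightarrow>
    sound g' u \<^bold>\<rightarrow> complete g' u \<^bold>\<rightarrow> ForallGimel U (agree g g' u)"
  unfolding Agree_def
proof (intro realizes_Lam)
  fix T L d c d' c'
  assume T: "T \<tturnstile> transitive_order" and L: "L \<tturnstile> least_elements"
    and d: "d \<tturnstile> sound g u" and c: "c \<tturnstile> complete g u"
    and d': "d' \<tturnstile> sound g' u" and c': "c' \<tturnstile> complete g' u"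
    and tm: "is_term T" "is_term L" "is_term d" "is_term c" "is_term d'" "is_term c'"
  let ?s = "s(0 := T, 1 := L, 2 := d, 3 := c, 4 := d', 5 := c')"
  have e: "env ?s" using s tm by simp
  from realizes_ap[OF realizes_ap[OF realizes_Ind[OF e definable_agree] L]
      realizes_ap[OF realizes_ap[OF realizes_ap[OF realizes_ap[OF realizes_ap[OF
        realizes_Agree_step[OF e u] T] d] c] d'] c']]
  show "ev ?s (Ind \<bullet> V 1 \<bullet> (Agree_step \<bullet> V 0 \<bullet> V 2 \<bullet> V 3 \<bullet> V 4 \<bullet> V 5)) \<tturnstile>
      ForallGimel U (agree g g' u)"
    by simp
qed (use s in simp_all)

text \<open>Holding everywhere, this makes the selection a kernel in the sense of graph theory, for
  the relation of having a predecessor with a common coordinate: an element is selected if and only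
  if it conflicts with no selected predecessor.\<close>

definition fixpoint :: "'m \<Rightarrow> 'm \<Rightarrow> 'm zfe" where
  "fixpoint g u = ((NotEps u g \<^bold>\<rightarrow> avoids g u) \<^bold>\<and> (avoids g u \<^bold>\<rightarrow> NotEps u g))"

lemma definable_fixpoint: "definable_family (\<lambda>e. fixpoint g (e 0))"
  unfolding fixpoint_def avoids_def
  by (intro definable_family_intros definable_family_Conj definable_family_Eps definable_a definable_b)

text \<open>The definition of \<open>matched\<close> is impredicative: it ranges over all
  individuals, \<open>G\<close> among them. Once \<open>G\<close> is an approximation below
  \<open>u\<close>, instantiating with \<open>G\<close> gives one direction. For the other, any
  approximation agrees with \<open>G\<close> below \<open>u\<close>, so that avoiding
  \<open>G\<close> transfers to it.\<close>

lemma realizes_Kernel_step: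
  assumes s: "env s" and u: "u \<in>\<^sub>M U" and G: "falsity (NotEps u G) = falsity (matched u)"
  shows "ev s Kernel_step \<tturnstile> transitive_order \<^bold>\<rightarrow> least_elements \<^bold>\<rightarrow> sound G u \<^bold>\<rightarrow> complete G u \<^bold>\<rightarrow>
    fixpoint G u"
  unfolding Kernel_step_def
proof (intro realizes_Lam)
  fix T L d c
  assume T: "T \<tturnstile> transitive_order" and L: "L \<tturnstile> least_elements"
    and d: "d \<tturnstile> sound G u" and c: "c \<tturnstile> complete G u"
    and tm: "is_term T" "is_term L" "is_term d" "is_term c"
  let ?s = "s(0 := T, 1 := L, 2 := d, 3 := c)"
  have e: "env ?s" using s tm by simp
  have 1: "ev ?s (Lam 4 (V 4 \<bullet> V 2 \<bullet> V 3)) \<tturnstile> NotEps u G \<^bold>\<rightarrow> avoids G u"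
  proof (rule realizes_Lam[OF e])
    fix p assume "p \<tturnstile> NotEps u G"
    then have "p \<tturnstile> matched u" by (rule realizes_cong[OF G])
    then have "p \<tturnstile> sound G u \<^bold>\<rightarrow> complete G u \<^bold>\<rightarrow> avoids G u"
      unfolding matched_def by (rule realizes_ForallD)
    from realizes_ap[OF realizes_ap[OF this d] c]
    show "ev (?s(4 := p)) (V 4 \<bullet> V 2 \<bullet> V 3) \<tturnstile> avoids G u" by simp
  qed
  have 2: "ev ?s (Lam 4 (Lam 5 (Lam 6 (Transfer \<bullet>
      Lam 7 (Fst \<bullet> (Agree \<bullet> V 0 \<bullet> V 1 \<bullet> V 5 \<bullet> V 6 \<bullet> V 2 \<bullet> V 3 \<bullet> V 7)) \<bullet> V 4)))) \<tturnstile>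
      avoids G u \<^bold>\<rightarrow> matched u"
    unfolding matched_def
  proof (intro realizes_Lam realizes_Forall)
    fix x g d' c'
    assume x: "x \<tturnstile> avoids G u" and d': "d' \<tturnstile> sound g u" and c': "c' \<tturnstile> complete g u"
      and tm': "is_term x" "is_term d'" "is_term c'"
    let ?t = "?s(4 := x, 5 := d', 6 := c')"
    have e': "env ?t" using e tm' by simp
    have "ev ?t (Lam 7 (Fst \<bullet> (Agree \<bullet> V 0 \<bullet> V 1 \<bullet> V 5 \<bullet> V 6 \<bullet> V 2 \<bullet> V 3 \<bullet> V 7))) \<tturnstile>
        ForallGimel U (\<lambda>v. lt v u \<^bold>\<rightarrow> NotEps v g \<^bold>\<rightarrow> NotEps v G)"
    proof (intro realizes_ForallGimel realizes_Lam e')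
      fix v l assume v: "v \<in>\<^sub>M U" and l: "l \<tturnstile> lt v u" "is_term l"
      have e7: "env (?t(7 := l))" using e' l by simp
      note agree = realizes_ForallGimelD[OF realizes_ap[OF realizes_ap[OF realizes_ap[OF realizes_ap[OF
        realizes_ap[OF realizes_ap[OF realizes_Agree[OF e7 u] T] L] d'] c'] d] c] v]
      from realizes_Fst_ap[OF e7 realizes_ap[OF agree[unfolded agree_def] l(1)]]
      show "ev (?t(7 := l)) (Fst \<bullet> (Agree \<bullet> V 0 \<bullet> V 1 \<bullet> V 5 \<bullet> V 6 \<bullet> V 2 \<bullet> V 3 \<bullet> V 7)) \<tturnstile>
          NotEps v g \<^bold>\<rightarrow> NotEps v G"
        by simp
    qed (use e' in simp)
    from realizes_ap[OF realizes_ap[OF realizes_Transfer[OF e'] this] x]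
    show "ev ?t (Transfer \<bullet> Lam 7 (Fst \<bullet> (Agree \<bullet> V 0 \<bullet> V 1 \<bullet> V 5 \<bullet> V 6 \<bullet> V 2 \<bullet> V 3 \<bullet> V 7)) \<bullet> V 4)
        \<tturnstile> avoids g u"
      by simp
  qed (use e in simp_all)
  have "falsity (avoids G u \<^bold>\<rightarrow> matched u) = falsity (avoids G u \<^bold>\<rightarrow> NotEps u G)"
    using G by (intro falsity_Imp_cong) simp_all
  from realizes_ap[OF realizes_ap[OF realizes_Pair[OF e] 1] realizes_cong[OF this 2]]
  show "ev ?s (Pair \<bullet> Lam 4 (V 4 \<bullet> V 2 \<bullet> V 3) \<bullet>
    Lam 4 (Lam 5 (Lam 6 (Transfer \<bullet>
      Lam 7 (Fst \<bullet> (Agree \<bullet> V 0 \<bullet> V 1 \<bullet> V 5 \<bullet> V 6 \<bullet> V 2 \<bullet> V 3 \<bullet> V 7)) \<bullet> V 4)))) \<tturnstile> fixpoint G u"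
    unfolding fixpoint_def by simp
qed (use s in simp_all)

text \<open>Along the ordering, the two halves of the induction hypothesis are exactly soundness and
  completeness of \<open>G\<close> below \<open>u\<close>.\<close>

lemma realizes_Kernel:
  assumes s: "env s" and G: "\<And>u. u \<in>\<^sub>M U \<Longrightarrow> falsity (NotEps u G) = falsity (matched u)"
  shows "ev s Kernel \<tturnstile> transitive_order \<^bold>\<rightarrow> least_elements \<^bold>\<rightarrow> ForallGimel U (fixpoint G)"
  unfolding Kernel_def
proof (intro realizes_Lam)
  fix T L
  assume T: "T \<tturnstile> transitive_order" and L: "L \<tturnstile> least_elements"
    and tm: "is_term T" "is_term L"
  let ?s = "s(0 := T, 1 := L)"
  have e: "env ?s" using s tm by simp
  have "ev ?s (Lam 2 (Kernel_step \<bullet> V 0 \<bullet> V 1 \<bullet>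
    Lam 3 (Fst \<bullet> (V 2 \<bullet> V 3)) \<bullet> Lam 3 (Snd \<bullet> (V 2 \<bullet> V 3)))) \<tturnstile> progressive (fixpoint G)"
    unfolding progressive_def
  proof (intro realizes_ForallGimel realizes_Lam e)
    fix u h assume u: "u \<in>\<^sub>M U" and tmh: "is_term h"
      and h: "h \<tturnstile> ForallGimel U (\<lambda>y. lt y u \<^bold>\<rightarrow> fixpoint G y)"
    let ?t = "?s(2 := h)"
    have e': "env ?t" using e tmh by simp
    have 1: "ev ?t (Lam 3 (Fst \<bullet> (V 2 \<bullet> V 3))) \<tturnstile> sound G u" unfolding sound_def
    proof (intro realizes_ForallGimel realizes_Lam e')
      fix v l assume v: "v \<in>\<^sub>M U" and l: "l \<tturnstile> lt v u" "is_term l"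
      have "env (?t(3 := l))" using e' l by simp
      from realizes_Fst_ap[OF this
          realizes_ap[OF realizes_ForallGimelD[OF h v] l(1), unfolded fixpoint_def]]
      show "ev (?t(3 := l)) (Fst \<bullet> (V 2 \<bullet> V 3)) \<tturnstile> NotEps v G \<^bold>\<rightarrow> avoids G v" by simp
    qed (use e' in simp)
    have 2: "ev ?t (Lam 3 (Snd \<bullet> (V 2 \<bullet> V 3))) \<tturnstile> complete G u" unfolding complete_def
    proof (intro realizes_ForallGimel realizes_Lam e')
      fix v l assume v: "v \<in>\<^sub>M U" and l: "l \<tturnstile> lt v u" "is_term l"
      have "env (?t(3 := l))" using e' l by simp
      from realizes_Snd_ap[OF this
          realizes_ap[OF realizes_ForallGimelD[OF h v] l(1), unfolded fixpoint_def]]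
      show "ev (?t(3 := l)) (Snd \<bullet> (V 2 \<bullet> V 3)) \<tturnstile> avoids G v \<^bold>\<rightarrow> NotEps v G" by simp
    qed (use e' in simp)
    from realizes_ap[OF realizes_ap[OF realizes_ap[OF realizes_ap[OF
          realizes_Kernel_step[OF e' u G[OF u]] T] L] 1] 2]
    show "ev ?t (Kernel_step \<bullet> V 0 \<bullet> V 1 \<bullet>
        Lam 3 (Fst \<bullet> (V 2 \<bullet> V 3)) \<bullet> Lam 3 (Snd \<bullet> (V 2 \<bullet> V 3))) \<tturnstile> fixpoint G u"
      by simp
  qed (use e in simp)
  from realizes_ap[OF realizes_ap[OF realizes_Ind[OF e definable_fixpoint] L] this]
  show "ev ?s (Ind \<bullet> V 1 \<bullet> Lam 2 (Kernel_step \<bullet> V 0 \<bullet> V 1 \<bullet>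
      Lam 3 (Fst \<bullet> (V 2 \<bullet> V 3)) \<bullet> Lam 3 (Snd \<bullet> (V 2 \<bullet> V 3)))) \<tturnstile> ForallGimel U (fixpoint G)"
    by simp
qed (use s in simp_all)

text \<open>Selected elements avoid only their predecessors. Totality decides which of
  \<open>u\<close> and \<open>v\<close> comes first, and the symmetry of \<open>a\<close> and
  \<open>b\<close> makes the outcome the same in both cases.\<close>

lemma realizes_Matching:
  assumes s: "env s" and u: "u \<in>\<^sub>M U" and v: "v \<in>\<^sub>M U"
  shows "ev s Matching \<tturnstile> total_order \<^bold>\<rightarrow> ForallGimel U (fixpoint G) \<^bold>\<rightarrow>
    NotEps u G \<^bold>\<rightarrow> NotEps v G \<^bold>\<rightarrow> Neq u v \<^bold>\<rightarrow> (a v u \<^bold>\<rightarrow> b v u \<^bold>\<rightarrow> Bot) \<^bold>\<rightarrow> Bot"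
  unfolding Matching_def
proof (intro realizes_Lam)
  fix t f p q n k
  assume t: "t \<tturnstile> total_order" and f: "f \<tturnstile> ForallGimel U (fixpoint G)"
    and p: "p \<tturnstile> NotEps u G" and q: "q \<tturnstile> NotEps v G" and n: "n \<tturnstile> Neq u v"
    and k: "k \<tturnstile> a v u \<^bold>\<rightarrow> b v u \<^bold>\<rightarrow> Bot"
    and tm: "is_term t" "is_term f" "is_term p" "is_term q" "is_term n" "is_term k"
  let ?s = "s(0 := t, 1 := f, 2 := p, 3 := q, 4 := n, 5 := k)"
  have e: "env ?s" using s tm by simp
  have avoids: "ap (ev s' Fst) f \<tturnstile> NotEps w G \<^bold>\<rightarrow> avoids G w" if "env s'" "w \<in>\<^sub>M U" for s' w
    by (rule realizes_Fst_ap[OF that(1) realizes_ForallGimelD[OF f that(2), unfolded fixpoint_def]])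
  have k': "k \<tturnstile> a u v \<^bold>\<rightarrow> b u v \<^bold>\<rightarrow> Bot"
    by (rule realizes_cong[OF _ k]) (intro falsity_Imp_cong a_sym b_sym refl)
  \<comment> \<open>The case \<open>lt u v\<close> is refuted outright; \<open>TCC\<close> turns
    this refutation into the formula \<open>NotEps (pair u v) r\<close> that
    \<open>total_order\<close> expects.\<close>
  have "ev ?s (Lam 6 (Fst \<bullet> V 1 \<bullet> V 3 \<bullet> V 6 \<bullet> V 2 \<bullet> V 5)) \<tturnstile> (NotEps (pair u v) r \<^bold>\<rightarrow> Bot) \<^bold>\<rightarrow> Bot"
  proof (rule realizes_Lam[OF e])
    fix l assume l: "l \<tturnstile> NotEps (pair u v) r \<^bold>\<rightarrow> Bot" "is_term l"
    then have l': "l \<tturnstile> lt u v" by (simp add: Eps_def Neg_def)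
    have e': "env (?s(6 := l))" using e l by simp
    note x = realizes_ap[OF avoids[OF e' v] q, unfolded avoids_def]
    from realizes_ap[OF realizes_ap[OF realizes_ap[OF realizes_ForallGimelD[OF x u] l'] p,
        unfolded Conj_def] k']
    show "ev (?s(6 := l)) (Fst \<bullet> V 1 \<bullet> V 3 \<bullet> V 6 \<bullet> V 2 \<bullet> V 5) \<tturnstile> Bot" by simp
  qed
  note l = realizes_ap[OF realizes_ap[OF total_orderD[OF t u v] n] realizes_cc[OF this]]
  note x = realizes_ap[OF avoids[OF e u] p, unfolded avoids_def]
  from realizes_ap[OF realizes_ap[OF realizes_ap[OF realizes_ForallGimelD[OF x v] l] q,
      unfolded Conj_def] k]
  show "ev ?s (Fst \<bullet> V 1 \<bullet> V 2 \<bullet>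
    (V 0 \<bullet> V 4 \<bullet> (TCC \<bullet> Lam 6 (Fst \<bullet> V 1 \<bullet> V 3 \<bullet> V 6 \<bullet> V 2 \<bullet> V 5))) \<bullet> V 3 \<bullet> V 5) \<tturnstile> Bot"
    by simp
qed (use s in simp_all)

text \<open>Why a kernel must cover X or Y: if neither coordinate of \<open>w\<close> occurs in a
  selected element, then \<open>w\<close> avoids the selection and is itself selected, so its
  coordinate in Y does occur. The contradiction appears as \<open>b w w\<close>, which has falsity
  value \<Pi> in both threads.\<close>

lemma realizes_Unmatched:
  assumes s: "env s" and w: "w \<in>\<^sub>M U"
  shows "ev s Unmatched \<tturnstile> ForallGimel U (fixpoint G) \<^bold>\<rightarrow>
    ForallGimel U (\<lambda>v. NotEps v G \<^bold>\<rightarrow> a v w) \<^bold>\<rightarrow> ForallGimel U (\<lambda>v. NotEps v G \<^bold>\<rightarrow> b v w) \<^bold>\<rightarrow> b w w"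
  unfolding Unmatched_def
proof (intro realizes_Lam)
  fix f x y
  assume f: "f \<tturnstile> ForallGimel U (fixpoint G)"
    and x: "x \<tturnstile> ForallGimel U (\<lambda>v. NotEps v G \<^bold>\<rightarrow> a v w)"
    and y: "y \<tturnstile> ForallGimel U (\<lambda>v. NotEps v G \<^bold>\<rightarrow> b v w)"
    and tm: "is_term f" "is_term x" "is_term y"
  let ?s = "s(0 := f, 1 := x, 2 := y)"
  have e: "env ?s" using s tm by simp
  have "ev ?s (Lam 3 (Lam 4 (Lam 5 (V 5 \<bullet> (V 1 \<bullet> V 4) \<bullet> (V 2 \<bullet> V 4))))) \<tturnstile> avoids G w"
    unfolding avoids_def Conj_def
  proof (intro realizes_ForallGimel realizes_Lam)
    fix v l p k
    assume v: "v \<in>\<^sub>M U" and p: "p \<tturnstile> NotEps v G" and k: "k \<tturnstile> a v w \<^bold>\<rightarrow> b v w \<^bold>\<rightarrow> Bot"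
    from realizes_ap[OF realizes_ap[OF k realizes_ap[OF realizes_ForallGimelD[OF x v] p]]
        realizes_ap[OF realizes_ForallGimelD[OF y v] p]]
    show "ev (?s(3 := l, 4 := p, 5 := k)) (V 5 \<bullet> (V 1 \<bullet> V 4) \<bullet> (V 2 \<bullet> V 4)) \<tturnstile> Bot" by simp
  qed (use e in simp_all)
  from realizes_ap[OF realizes_ForallGimelD[OF y w] realizes_ap[OF realizes_Snd_ap[OF e
        realizes_ForallGimelD[OF f w, unfolded fixpoint_def]] this]]
  show "ev ?s (V 2 \<bullet> (Snd \<bullet> V 0 \<bullet>
      Lam 3 (Lam 4 (Lam 5 (V 5 \<bullet> (V 1 \<bullet> V 4) \<bullet> (V 2 \<bullet> V 4)))))) \<tturnstile> b w w"
    by simp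
qed (use s in simp_all)

end

section \<open>The two threads\<close>

text \<open>
  An element of \<open>\<gimel>2\<close> splits the elements of \<open>\<gimel>U\<close> into two coordinates.  The formulas \<open>a u v\<close> and \<open>b u v\<close>
  say that the coordinates below \<open>i\<close>, respectively below the complement of \<open>i\<close>, differ; for \<open>i = 0\<close>
  the former are always equal and the latter are the elements themselves, for \<open>i = 1\<close> conversely.
\<close>

locale two_threads =
  greedy mem A "set_structure.powerset mem k" r
    "\<lambda>u v. if i = set_structure.zero mem then Bot else Neq u v"
    "\<lambda>u v. if i = set_structure.zero mem then Neq u v else Bot"
  for mem :: "'m \<Rightarrow> 'm \<Rightarrow> bool"  (infix "\<in>\<^sub>M" 50) and A :: "'m realizability_structure"
    and k r i :: 'm +
  fixes h B :: 'm
  assumes i: "i = zero \<or> i = one"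
    and bij: "is_bij h k B"
    and stacks_subset: "\<And>p. is_stack p \<Longrightarrow> p \<in>\<^sub>M B"
begin

text \<open>The terms \<open>x\<close> and \<open>y\<close> realize that the two coordinates of some
  \<open>w\<close> are uncovered. In each thread one of them does so for every \<open>w\<close>,
  because its hypothesis \<open>c0\<close> or \<open>c1\<close> realizes \<open>Bot\<close>, and the
  other does so for a \<open>w\<close> found by counting.\<close>

lemma realizes_Contradiction:
  assumes s: "env s"
  shows "ev s Contradiction \<tturnstile> Neq i zero \<^bold>\<rightarrow> Neq i one \<^bold>\<rightarrow>
    transitive_order \<^bold>\<rightarrow> total_order \<^bold>\<rightarrow> least_elements \<^bold>\<rightarrow> Bot"
  unfolding Contradiction_def
proof (intro realizes_Lam)
  fix c0 c1 T t L
  assume c0: "c0 \<tturnstile> Neq i zero" and c1: "c1 \<tturnstile> Neq i one" and T: "T \<tturnstile> transitive_order"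
    and t: "t \<tturnstile> total_order" and L: "L \<tturnstile> least_elements"
    and tm: "is_term c0" "is_term c1" "is_term T" "is_term t" "is_term L"
  let ?s = "s(0 := c0, 1 := c1, 2 := T, 3 := t, 4 := L)"
  have e: "env ?s" using s tm by simp
  obtain G where G: "\<And>u. u \<in>\<^sub>M powerset k \<Longrightarrow> falsity (NotEps u G) = falsity (matched u)"
    using comprehension[OF definable_matched, of "powerset k"] by metis
  let ?P = "\<lambda>u. NotEps u G"
  let ?a = "\<lambda>u v. if i = zero then Bot else Neq u v"
  let ?b = "\<lambda>u v. if i = zero then Neq u v else Bot"
  define f where "f = ap (ap (ev ?s Kernel) T) L"
  define m where "m = ap (ap (ev ?s Matching) t) f"
  define x where "x = ap (ap (ap (ev ?s Escape) m) c0) (ap (InsK A) (InsI A))"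
  define y where "y = ap (ap (ap (ev ?s Escape) m) c1) (InsK A)"
  have f: "f \<tturnstile> ForallGimel (powerset k) (fixpoint G)"
    unfolding f_def by (rule realizes_ap[OF realizes_ap[OF realizes_Kernel[OF e G] T] L])
  have m: "m \<tturnstile> ?P u \<^bold>\<rightarrow> ?P v \<^bold>\<rightarrow> Neq u v \<^bold>\<rightarrow> (?a v u \<^bold>\<rightarrow> ?b v u \<^bold>\<rightarrow> Bot) \<^bold>\<rightarrow> Bot"
    if "u \<in>\<^sub>M powerset k" "v \<in>\<^sub>M powerset k" for u v
    unfolding m_def by (rule realizes_ap[OF realizes_ap[OF realizes_Matching[OF e that] t] f])
  have tm': "is_term f" "is_term m" "is_term x" "is_term y"
    using e tm by (simp_all add: f_def m_def x_def y_def)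
  \<comment> \<open>This covers two uses. For i = 0 take u = v: then \<open>c0\<close> realizes
    \<open>Bot\<close>, hence \<open>Neq u u\<close>. For i = 1 a genuine collision u \<noteq> v is
    needed: \<open>Neq u v\<close> then has empty falsity value and \<open>c0\<close> is a dummy.
    The selector K I picks the component that amounts to \<open>Bot\<close>.\<close>
  have x: "x \<star> q \<in>\<^sub>M Pole A"
    if "u \<in>\<^sub>M powerset k" "v \<in>\<^sub>M powerset k" "i = zero \<or> u \<noteq> v"
      "q \<in> falsity (?P u \<^bold>\<rightarrow> Bot)" "q \<in> falsity (?P v \<^bold>\<rightarrow> Bot)" "?b v u = Bot \<or> u = v" for u v q
  proof -
    have 1: "c0 \<tturnstile> Neq u v"
      using that(3) c0 by (auto simp: realizes_def)
    have "ap (InsK A) (InsI A) \<tturnstile> ?a v u \<^bold>\<rightarrow> ?b v u \<^bold>\<rightarrow> ?b v u" by (rule realizes_KI)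
    then have 2: "ap (InsK A) (InsI A) \<tturnstile> ?a v u \<^bold>\<rightarrow> ?b v u \<^bold>\<rightarrow> Bot"
      by (rule realizes_cong[rotated]) (intro falsity_Imp_cong refl, use that(6) in auto)
    show ?thesis
      unfolding x_def by (rule Pole_Escape[OF e _ _ that(4,5) m[OF that(1,2)] 1 2]) (simp_all add: tm)
  qed
  \<comment> \<open>Here the threads are exchanged: \<open>c1\<close> realizes \<open>Bot\<close>
    for i = 1, and K picks the other component.\<close>
  have y: "y \<star> q \<in>\<^sub>M Pole A"
    if "u \<in>\<^sub>M powerset k" "v \<in>\<^sub>M powerset k" "i = one \<or> u \<noteq> v"
      "q \<in> falsity (?P u \<^bold>\<rightarrow> Bot)" "q \<in> falsity (?P v \<^bold>\<rightarrow> Bot)" "?a v u = Bot \<or> u = v" for u v q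
  proof -
    have 1: "c1 \<tturnstile> Neq u v"
      using that(3) c1 by (auto simp: realizes_def)
    have "InsK A \<tturnstile> ?a v u \<^bold>\<rightarrow> ?b v u \<^bold>\<rightarrow> ?a v u" by (rule realizes_K)
    then have 2: "InsK A \<tturnstile> ?a v u \<^bold>\<rightarrow> ?b v u \<^bold>\<rightarrow> Bot"
      by (rule realizes_cong[rotated]) (intro falsity_Imp_cong refl, use that(6) in auto)
    show ?thesis
      unfolding y_def by (rule Pole_Escape[OF e _ _ that(4,5) m[OF that(1,2)] 1 2]) (simp_all add: tm)
  qed
  have "\<exists>w. w \<in>\<^sub>M powerset k \<and> (x \<tturnstile> ForallGimel (powerset k) (\<lambda>v. ?P v \<^bold>\<rightarrow> ?a v w)) \<and>
      (y \<tturnstile> ForallGimel (powerset k) (\<lambda>v. ?P v \<^bold>\<rightarrow> ?b v w))"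
  proof (cases "i = zero")
    case True
    obtain w where w: "w \<in>\<^sub>M powerset k" "y \<tturnstile> ?P w \<^bold>\<rightarrow> Bot"
      using realizes_not_mem_of_no_collision[OF bij stacks_subset tm'(4), of G] y True by auto
    \<comment> \<open>Refuting selection at the single point \<open>w\<close> is enough, since
      \<open>Neq v w\<close> has empty falsity value for all other \<open>v\<close>.\<close>
    have "y \<tturnstile> ?P v \<^bold>\<rightarrow> Neq v w" for v
      using w(2) tm'(4) by (cases "v = w") (auto simp: realizes_def)
    moreover have "x \<tturnstile> ?P v \<^bold>\<rightarrow> Bot" if "v \<in>\<^sub>M powerset k" for v
      by (rule realizesI[OF tm'(3)], rule x[OF that that]) (use True in auto)
    ultimately show ?thesis
      using w(1) True tm' by (intro exI[of _ w] conjI realizes_ForallGimel) simp_all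
  next
    case False
    then have i1: "i = one" using i by simp
    obtain w where w: "w \<in>\<^sub>M powerset k" "x \<tturnstile> ?P w \<^bold>\<rightarrow> Bot"
      using realizes_not_mem_of_no_collision[OF bij stacks_subset tm'(3), of G] x False by auto
    have "x \<tturnstile> ?P v \<^bold>\<rightarrow> Neq v w" for v
      using w(2) tm'(3) by (cases "v = w") (auto simp: realizes_def)
    moreover have "y \<tturnstile> ?P v \<^bold>\<rightarrow> Bot" if "v \<in>\<^sub>M powerset k" for v
      by (rule realizesI[OF tm'(4)], rule y[OF that that]) (use i1 in auto)
    ultimately show ?thesis
      using w(1) False tm' by (intro exI[of _ w] conjI realizes_ForallGimel) simp_all
  qed
  then obtain w where w: "w \<in>\<^sub>M powerset k"
    and x': "x \<tturnstile> ForallGimel (powerset k) (\<lambda>v. ?P v \<^bold>\<rightarrow> ?a v w)"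
    and y': "y \<tturnstile> ForallGimel (powerset k) (\<lambda>v. ?P v \<^bold>\<rightarrow> ?b v w)" by blast
  have "ap (ap (ap (ev ?s Unmatched) f) x) y \<tturnstile> ?b w w"
    by (rule realizes_ap[OF realizes_ap[OF realizes_ap[OF realizes_Unmatched[OF e w] f] x'] y'])
  then have "ap (ap (ap (ev ?s Unmatched) f) x) y \<tturnstile> Bot"
    by (rule realizes_cong[rotated]) simp
  then show "ev ?s (Unmatched \<bullet> (Kernel \<bullet> V 2 \<bullet> V 4) \<bullet>
    (Escape \<bullet> (Matching \<bullet> V 3 \<bullet> (Kernel \<bullet> V 2 \<bullet> V 4)) \<bullet> V 0 \<bullet> (TK \<bullet> TI)) \<bullet>
    (Escape \<bullet> (Matching \<bullet> V 3 \<bullet> (Kernel \<bullet> V 2 \<bullet> V 4)) \<bullet> V 1 \<bullet> TK)) \<tturnstile> Bot"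
    by (simp add: x_def y_def m_def f_def)
qed (use s in simp_all)

end

section \<open>One proof-like term for both threads\<close>

context zf_realizability
begin

lemma two_threadsI:
  assumes "i \<in>\<^sub>M two" "is_bij h k B" "\<And>p. is_stack p \<Longrightarrow> p \<in>\<^sub>M B"
  shows "two_threads mem A k i h B"
proof -
  have "definable_family (\<lambda>e. if i = zero then Bot else Neq (e m) (e n))"
    "definable_family (\<lambda>e. if i = zero then Neq (e m) (e n) else Bot)" for m n
    by (cases "i = zero"; simp; intro definable_family_intros)+
  then show ?thesis
    using assms by unfold_locales (auto simp: mem_two)
qed

lemma realizes_Not_well_orderable:
  assumes s: "env s" and bij: "is_bij h k B" and B: "\<And>p. is_stack p \<Longrightarrow> p \<in>\<^sub>M B"
  shows "ev s Not_well_orderable \<tturnstile>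
    ForallGimel two (\<lambda>i. Neq i zero \<^bold>\<rightarrow> Neq i one \<^bold>\<rightarrow> Neg (well_orderable (gimel (powerset k))))"
  unfolding Neg_def well_orderable_def Exists_def Not_well_orderable_def
proof (intro realizes_ForallGimel realizes_Lam)
  fix i c0 c1 w
  assume i: "i \<in>\<^sub>M two" and c: "c0 \<tturnstile> Neq i zero" "c1 \<tturnstile> Neq i one" "is_term c0" "is_term c1"
    and w: "w \<tturnstile> Forall (\<lambda>r. well_orders r (gimel (powerset k)) \<^bold>\<rightarrow> Bot) \<^bold>\<rightarrow> Bot" "is_term w"
  let ?s = "s(0 := c0, 1 := c1, 2 := w)"
  have e: "env ?s" using s c w by simp
  have "ev ?s (Lam 3 (Well_order \<bullet> V 3 \<bullet> (Contradiction \<bullet> V 0 \<bullet> V 1))) \<tturnstile>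
    Forall (\<lambda>r. well_orders r (gimel (powerset k)) \<^bold>\<rightarrow> Bot)"
  proof (intro realizes_Forall realizes_Lam e)
    fix r wo assume wo: "wo \<tturnstile> well_orders r (gimel (powerset k))" "is_term wo"
    interpret two_threads mem A k r i h B by (rule two_threadsI[OF i bij B])
    have e': "env (?s(3 := wo))" using e wo by simp
    from realizes_ap[OF realizes_ap[OF realizes_Well_order[OF e'] wo(1)]
        realizes_ap[OF realizes_ap[OF realizes_Contradiction[OF e'] c(1)] c(2)]]
    show "ev (?s(3 := wo)) (Well_order \<bullet> V 3 \<bullet> (Contradiction \<bullet> V 0 \<bullet> V 1)) \<tturnstile> Bot" by simp
  qed
  from realizes_ap[OF w(1) this]
  show "ev ?s (V 2 \<bullet> Lam 3 (Well_order \<bullet> V 3 \<bullet>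
      (Contradiction \<bullet> V 0 \<bullet> V 1))) \<tturnstile> Bot" by simp
qed (use s in simp_all)

lemma realized_not_well_orderable:
  assumes "is_bij h k B" "\<And>p. is_stack p \<Longrightarrow> p \<in>\<^sub>M B"
  shows "realized (ForallGimel two (\<lambda>i. Neq i zero \<^bold>\<rightarrow> Neq i one \<^bold>\<rightarrow>
    Neg (well_orderable (gimel (powerset k)))))"
proof -
  \<comment> \<open>The term is closed, so the values of the variables are immaterial; a proof-like
    filler makes its evaluation proof-like.\<close>
  have "env (\<lambda>_. InsI A)" by (simp add: env_def)
  from realizes_Not_well_orderable[OF this assms] show ?thesis
    unfolding realized_def using ev_ProofLike[of "\<lambda>_. InsI A"] by auto
qed

end

theorem theorem26:
  fixes mem :: "'m \<Rightarrow> 'm \<Rightarrow> bool"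
    and A :: "'m realizability_structure"
    and \<kappa> :: 'm
  assumes "set_structure.ZF mem"
    and "set_structure.V_eq_L mem"
    and "realizability_model.realizability_algebra mem A"
    and "realizability_model.coherent mem A"
    and "set_structure.is_card mem \<kappa>
      (set_structure.union mem (set_structure.union mem (Terms A) (Stacks A))
        (set_structure.omega mem))"
  shows "realizability_model.realized mem A
    (ForallGimel (set_structure.two mem) (\<lambda>i.
      Neq i (set_structure.zero mem) \<^bold>\<rightarrow> Neq i (set_structure.one mem) \<^bold>\<rightarrow>
      Neg (realizability_model.well_orderable mem
        (realizability_model.gimel mem A (set_structure.powerset mem \<kappa>)))))"
proof -
  interpret zf_realizability mem A
    using assms(1,3) by unfold_locales
  obtain h where h: "is_bij h \<kappa> (union (union (Terms A) (Stacks A)) omega)"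
    using assms(5) unfolding is_card_def by blast
  then show ?thesis
    by (rule realized_not_well_orderable) simp
qed

end
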